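(* Let $k\ge1$ and $n\ge k$ be integers and let $\pi,\sigma\in D_k$. Label the blocks (strings) of $\pi$ as $\pi_1,\ldots,\pi_k$ and those of $\sigma$ as $\sigma_1,\ldots,\sigma_k$, and define ${\bf a}\in M_{k\times k}(\mathbb N)$ by $a_{ij}=\#\{r\in\{1,\ldots,2k\}: r\in\pi_i,\ r\in\sigma_j\}$ (so ${\bf a}$ has entries in $\{0,1,2\}$ and every row and column sums to $2$). Then $W_{kn}(\pi,\sigma)=I_n({\bf a})$.
   Context: $D_k$ is the set of pairings (partitions into blocks of size 2) of $\{1,\ldots,2k\}$. The Gram matrix $G_{kn}$ is the $D_k\times D_k$ matrix $G_{kn}(\pi,\sigma)=n^{|\pi\vee\sigma|}$, where $\pi\vee\sigma$ is the join in the lattice of set partitions and $|\cdot|$ is the number of blocks; for $n\ge k$ it is invertible and the Weingarten matrix is $W_{kn}=G_{kn}^{-1}$. For ${\bf a}=(a_{ij})\in M_{p\times q}(\mathbb N)$ with $p,q\le n$, $I_n({\bf a})=\int_{O_n}\prod_{i,j}u_{ij}^{a_{ij}}\,du$ with respect to the Haar probability measure on $O_n$. *)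

theory Defs
  imports "HOL-Probability.Probability"
begin

definition pairings :: "nat \<Rightarrow> nat set set set" where
  "pairings k = {p. partition_on {1..2*k} p \<and> (\<forall>B\<in>p. card B = 2)}"

definition refines :: "'a set set \<Rightarrow> 'a set set \<Rightarrow> bool" where
  "refines p q \<longleftrightarrow> (\<forall>B\<in>p. \<exists>C\<in>q. B \<subseteq> C)"

definition partition_join :: "'a set \<Rightarrow> 'a set set \<Rightarrow> 'a set set \<Rightarrow> 'a set set" where
  "partition_join A p q = (THE r. partition_on A r \<and> refines p r \<and> refines q r \<and>
      (\<forall>t. partition_on A t \<and> refines p t \<and> refines q t \<longrightarrow> refines r t))"

definition gram :: "nat \<Rightarrow> nat \<Rightarrow> nat set set \<Rightarrow> nat set set \<Rightarrow> real" where
  "gram k n p q = real n ^ card (partition_join {1..2*k} p q)"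

text \<open>W_{kn} = G_{kn}^{-1}, the inverse of the D_k x D_k matrix G_{kn}
  (matrices indexed by D_k are functions vanishing outside D_k x D_k).\<close>
definition weingarten :: "nat \<Rightarrow> nat \<Rightarrow> nat set set \<Rightarrow> nat set set \<Rightarrow> real" where
  "weingarten k n = (THE W.
      (\<forall>p q. (p \<notin> pairings k \<or> q \<notin> pairings k) \<longrightarrow> W p q = 0) \<and>
      (\<forall>p\<in>pairings k. \<forall>q\<in>pairings k.
         (\<Sum>t\<in>pairings k. gram k n p t * W t q) = (if p = q then 1 else 0)) \<and>
      (\<forall>p\<in>pairings k. \<forall>q\<in>pairings k.
         (\<Sum>t\<in>pairings k. W p t * gram k n t q) = (if p = q then 1 else 0)))"

text \<open>n x n real matrices are functions on {0..<n} x {0..<n} (extensional);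
  the entry u_{ij} of the paper (1-based) is u (i-1, j-1).\<close>
definition matrix_space :: "nat \<Rightarrow> (nat \<times> nat \<Rightarrow> real) measure" where
  "matrix_space n = PiM ({..<n} \<times> {..<n}) (\<lambda>_. borel)"

definition orth_group :: "nat \<Rightarrow> (nat \<times> nat \<Rightarrow> real) set" where
  "orth_group n = {u \<in> extensional ({..<n} \<times> {..<n}).
      \<forall>i<n. \<forall>j<n. (\<Sum>l<n. u (i, l) * u (j, l)) = (if i = j then 1 else 0)}"

definition mat_mult :: "nat \<Rightarrow> (nat \<times> nat \<Rightarrow> real) \<Rightarrow> (nat \<times> nat \<Rightarrow> real) \<Rightarrow> (nat \<times> nat \<Rightarrow> real)" where
  "mat_mult n g u = (\<lambda>ij\<in>{..<n} \<times> {..<n}. \<Sum>l<n. g (fst ij, l) * u (l, snd ij))"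

definition haar_orth :: "nat \<Rightarrow> (nat \<times> nat \<Rightarrow> real) measure" where
  "haar_orth n = (THE M.
      sets M = sets (restrict_space (matrix_space n) (orth_group n)) \<and>
      prob_space M \<and>
      (\<forall>g\<in>orth_group n. distr M M (mat_mult n g) = M))"

definition orth_integral :: "nat \<Rightarrow> nat \<Rightarrow> nat \<Rightarrow> (nat \<Rightarrow> nat \<Rightarrow> nat) \<Rightarrow> real" where
  "orth_integral n p q a =
     (LINT u|haar_orth n. (\<Prod>i<p. \<Prod>j<q. u (i, j) ^ a i j))"

end

theory Submission
  imports Defs
begin

text \<open>The matrix \<open>W (p, q) = \<integral> \<Prod>r. u (i r, j r)\<close>, with \<open>i\<close> and \<open>j\<close> any words whose kernels are \<open>p\<close> and
  \<open>q\<close>, is shown to be inverse to the Gram matrix. Since \<open>G (p, t)\<close> counts the words compatible with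
  both \<open>p\<close> and \<open>t\<close>, and since the columns of \<open>u\<close> are orthonormal, this reduces to the claim that an
  \<open>O\<^sub>n\<close>-invariant tensor \<open>T\<close> of order \<open>2k \<le> 2n\<close> satisfies \<open>T i = \<Sum>t. T (i\<^sub>t)\<close>, the sum being over
  the pairings \<open>t\<close> finer than the kernel of \<open>i\<close>. Sign changes and permutations of coordinates show
  that \<open>T i\<close> depends only on the kernel of \<open>i\<close> and vanishes if some fibre is odd; a fibre with at
  least four elements is split by differentiating the invariance under a plane rotation that
  involves an index not occurring in \<open>i\<close>, which exists because \<open>n \<ge> k\<close>.

  Haar measure is obtained by pushing Lebesgue measure, restricted to a ball of matrices, to \<open>O\<^sub>n\<close> by
  Gram--Schmidt orthonormalisation; a left-invariant and a right-invariant probability measure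
  coincide by Fubini, which gives uniqueness and invariance under transposition.\<close>

subsection \<open>The orthogonal group\<close>

text \<open>\<open>weingarten\<close> and \<open>haar_orth\<close> are definite descriptions, so a
  two-sided inverse has to be exhibited, and Haar measure has to be shown to exist and to be unique,
  before anything can be computed. Row words and column words are chosen independently for every
  pairing: labelling each position by the string that contains it then turns the entry at
  (\<open>p\<close>, \<open>s\<close>) directly into the monomial of the statement, also if
  \<open>p = s\<close>.

  What symmetry leaves open is the value of an invariant tensor at a word with only even fibres, one
  of them of size at least four, since such a word does not label a pairing. A rotation by a finite
  angle would relate it to many words at once. The derivative at angle zero changes one position at
  a time and expresses the value through words that have exactly one letter more. The number of
  letters therefore controls an induction, and splitting goes on until all fibres have size
  two.\<close>

definition mat_one :: "nat \<Rightarrow> (nat \<times> nat \<Rightarrow> real)" where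
  "mat_one n = (\<lambda>ij\<in>{..<n} \<times> {..<n}. if fst ij = snd ij then 1 else 0)"

definition mat_transp :: "nat \<Rightarrow> (nat \<times> nat \<Rightarrow> real) \<Rightarrow> (nat \<times> nat \<Rightarrow> real)" where
  "mat_transp n u = (\<lambda>ij\<in>{..<n} \<times> {..<n}. u (snd ij, fst ij))"

lemma mat_eqI:
  assumes "u \<in> extensional ({..<n} \<times> {..<n})" "v \<in> extensional ({..<n} \<times> {..<n})"
    and "\<And>i j. i < n \<Longrightarrow> j < n \<Longrightarrow> u (i, j) = v (i, j)"
  shows "u = v"
  using assms by (auto intro: extensionalityI)

lemma mat_mult_ext [simp]: "mat_mult n g u \<in> extensional ({..<n} \<times> {..<n})"
  by (simp add: mat_mult_def)

lemma mat_transp_ext [simp]: "mat_transp n u \<in> extensional ({..<n} \<times> {..<n})"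
  by (simp add: mat_transp_def)

lemma mat_one_ext [simp]: "mat_one n \<in> extensional ({..<n} \<times> {..<n})"
  by (simp add: mat_one_def)

lemma mat_mult_apply:
  "i < n \<Longrightarrow> j < n \<Longrightarrow> mat_mult n g u (i, j) = (\<Sum>l<n. g (i, l) * u (l, j))"
  by (simp add: mat_mult_def)

lemma mat_transp_apply: "i < n \<Longrightarrow> j < n \<Longrightarrow> mat_transp n u (i, j) = u (j, i)"
  by (simp add: mat_transp_def)

lemma mat_one_apply: "i < n \<Longrightarrow> j < n \<Longrightarrow> mat_one n (i, j) = (if i = j then 1 else 0)"
  by (simp add: mat_one_def)

lemma mat_mult_assoc: "mat_mult n (mat_mult n a b) c = mat_mult n a (mat_mult n b c)"
proof (rule mat_eqI)
  fix i j assume ij: "i < n" "j < n"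
  have "mat_mult n (mat_mult n a b) c (i, j) = (\<Sum>l<n. \<Sum>m<n. a (i, m) * (b (m, l) * c (l, j)))"
    using ij by (simp add: mat_mult_apply sum_distrib_right mult.assoc)
  also have "\<dots> = (\<Sum>m<n. \<Sum>l<n. a (i, m) * (b (m, l) * c (l, j)))"
    by (rule sum.swap)
  finally show "mat_mult n (mat_mult n a b) c (i, j) = mat_mult n a (mat_mult n b c) (i, j)"
    using ij by (simp add: mat_mult_apply sum_distrib_left)
qed auto

lemma mat_mult_one_left:
  "u \<in> extensional ({..<n} \<times> {..<n}) \<Longrightarrow> mat_mult n (mat_one n) u = u"
  by (rule mat_eqI) (auto simp: mat_mult_apply mat_one_apply if_distrib [of "\<lambda>x. x * _"] cong: if_cong)

lemma mat_transp_mult: "mat_transp n (mat_mult n a b) = mat_mult n (mat_transp n b) (mat_transp n a)"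
  by (rule mat_eqI [of _ n]) (simp_all add: mat_mult_apply mat_transp_apply mult.commute)

lemma mat_transp_transp: "u \<in> extensional ({..<n} \<times> {..<n}) \<Longrightarrow> mat_transp n (mat_transp n u) = u"
  by (rule mat_eqI) (auto simp: mat_transp_apply)

lemma mat_transp_one: "mat_transp n (mat_one n) = mat_one n"
  by (rule mat_eqI [of _ n]) (simp_all add: mat_transp_apply mat_one_apply)

lemma orth_group_ext: "u \<in> orth_group n \<Longrightarrow> u \<in> extensional ({..<n} \<times> {..<n})"
  by (simp add: orth_group_def)

lemma orth_group_rows:
  "u \<in> orth_group n \<Longrightarrow> i < n \<Longrightarrow> j < n \<Longrightarrow> (\<Sum>l<n. u (i, l) * u (j, l)) = (if i = j then 1 else 0)"
  by (simp add: orth_group_def)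

lemma sum_swap_pairs:
  fixes f :: "'a \<Rightarrow> 'b \<Rightarrow> 'c \<Rightarrow> 'd \<Rightarrow> real"
  shows "(\<Sum>i\<in>A. \<Sum>j\<in>B. \<Sum>l\<in>C. \<Sum>m\<in>D. f i j l m) = (\<Sum>l\<in>C. \<Sum>m\<in>D. \<Sum>i\<in>A. \<Sum>j\<in>B. f i j l m)"
proof -
  have "(\<Sum>j\<in>B. \<Sum>l\<in>C. \<Sum>m\<in>D. f i j l m) = (\<Sum>l\<in>C. \<Sum>m\<in>D. \<Sum>j\<in>B. f i j l m)" for i
    by (subst sum.swap) (intro sum.cong refl sum.swap)
  then have "(\<Sum>i\<in>A. \<Sum>j\<in>B. \<Sum>l\<in>C. \<Sum>m\<in>D. f i j l m) = (\<Sum>i\<in>A. \<Sum>l\<in>C. \<Sum>m\<in>D. \<Sum>j\<in>B. f i j l m)"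
    by simp
  also have "\<dots> = (\<Sum>l\<in>C. \<Sum>m\<in>D. \<Sum>i\<in>A. \<Sum>j\<in>B. f i j l m)"
    by (subst sum.swap) (intro sum.cong refl sum.swap)
  finally show ?thesis .
qed

text \<open>With \<open>P = u\<^sup>T u\<close>, row orthonormality gives \<open>tr (P P) = tr P = n\<close>,
  so the Frobenius norm of \<open>P - 1\<close> vanishes.\<close>
lemma orthonormal_rows_imp_columns:
  fixes u :: "nat \<times> nat \<Rightarrow> real"
  assumes rows: "\<And>i j. i < n \<Longrightarrow> j < n \<Longrightarrow> (\<Sum>l<n. u (i, l) * u (j, l)) = (if i = j then 1 else 0)"
    and ij: "i < n" "j < n"
  shows "(\<Sum>l<n. u (l, i) * u (l, j)) = (if i = j then 1 else 0)"
proof -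
  define P where "P i j = (\<Sum>l<n. u (l, i) * u (l, j))" for i j
  define d :: "nat \<Rightarrow> nat \<Rightarrow> real" where "d i j = (if i = j then 1 else 0)" for i j
  have trP: "(\<Sum>i<n. P i i) = real n"
  proof -
    have "(\<Sum>i<n. P i i) = (\<Sum>l<n. \<Sum>i<n. u (l, i) * u (l, i))"
      unfolding P_def by (rule sum.swap)
    also have "\<dots> = real n" using rows by simp
    finally show ?thesis .
  qed
  have trPP: "(\<Sum>i<n. \<Sum>j<n. P i j * P i j) = real n"
  proof -
    have "(\<Sum>i<n. \<Sum>j<n. P i j * P i j)
        = (\<Sum>i<n. \<Sum>j<n. \<Sum>l<n. \<Sum>m<n. (u (l, i) * u (m, i)) * (u (l, j) * u (m, j)))"
      unfolding P_def by (simp add: sum_product mult_ac)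
    also have "\<dots> = (\<Sum>l<n. \<Sum>m<n. \<Sum>i<n. \<Sum>j<n. (u (l, i) * u (m, i)) * (u (l, j) * u (m, j)))"
      by (rule sum_swap_pairs)
    also have "\<dots> = (\<Sum>l<n. \<Sum>m<n. (\<Sum>i<n. u (l, i) * u (m, i)) * (\<Sum>j<n. u (l, j) * u (m, j)))"
      by (simp add: sum_product)
    also have "\<dots> = (\<Sum>l<n. \<Sum>m<n. if l = m then 1 else 0)"
      using rows by (intro sum.cong refl) simp
    also have "\<dots> = real n" by simp
    finally show ?thesis .
  qed
  have "(\<Sum>i<n. \<Sum>j<n. (P i j - d i j)\<^sup>2)
      = (\<Sum>i<n. \<Sum>j<n. P i j * P i j - 2 * (if i = j then P i j else 0) + (if i = j then 1 else 0))"
    by (intro sum.cong refl) (auto simp: d_def power2_eq_square algebra_simps)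
  also have "\<dots> = (\<Sum>i<n. \<Sum>j<n. P i j * P i j) - 2 * (\<Sum>i<n. P i i) + real n"
    by (simp add: sum.distrib sum_subtractf flip: sum_distrib_left)
  also have "\<dots> = 0" using trP trPP by simp
  finally have 0: "(\<Sum>i<n. \<Sum>j<n. (P i j - d i j)\<^sup>2) = 0" .
  have "(\<Sum>j<n. (P i j - d i j)\<^sup>2) = 0"
    using 0 ij by (subst (asm) sum_nonneg_eq_0_iff) (auto intro: sum_nonneg)
  then have "(P i j - d i j)\<^sup>2 = 0"
    using ij by (subst (asm) sum_nonneg_eq_0_iff) auto
  then show ?thesis by (simp add: P_def d_def)
qed

lemma orth_group_columns:
  "u \<in> orth_group n \<Longrightarrow> i < n \<Longrightarrow> j < n \<Longrightarrow> (\<Sum>l<n. u (l, i) * u (l, j)) = (if i = j then 1 else 0)"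
  by (rule orthonormal_rows_imp_columns) (auto simp: orth_group_rows)

lemma orth_group_transp: "u \<in> orth_group n \<Longrightarrow> mat_transp n u \<in> orth_group n"
  using orth_group_columns [of u n] by (simp add: orth_group_def [of n] mat_transp_apply)

lemma orth_group_transp_iff:
  "u \<in> extensional ({..<n} \<times> {..<n}) \<Longrightarrow> mat_transp n u \<in> orth_group n \<longleftrightarrow> u \<in> orth_group n"
  using orth_group_transp mat_transp_transp by metis

lemma orth_group_iff:
  "u \<in> orth_group n \<longleftrightarrow> u \<in> extensional ({..<n} \<times> {..<n}) \<and> mat_mult n u (mat_transp n u) = mat_one n"
proof -
  have "mat_mult n u (mat_transp n u) = mat_one n \<longleftrightarrow>
      (\<forall>i<n. \<forall>j<n. (\<Sum>l<n. u (i, l) * u (j, l)) = (if i = j then 1 else 0))"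
    (is "?l = ?r")
  proof
    assume ?l
    show ?r
    proof (intro allI impI)
      fix i j assume "i < n" "j < n"
      then show "(\<Sum>l<n. u (i, l) * u (j, l)) = (if i = j then 1 else 0)"
        using fun_cong [OF \<open>?l\<close>, of "(i, j)"] by (simp add: mat_mult_apply mat_transp_apply mat_one_apply)
    qed
  next
    assume ?r
    then show ?l
      by (intro mat_eqI [of _ n]) (simp_all add: mat_mult_apply mat_transp_apply mat_one_apply)
  qed
  then show ?thesis by (simp add: orth_group_def)
qed

lemma orth_group_mult_transp: "u \<in> orth_group n \<Longrightarrow> mat_mult n u (mat_transp n u) = mat_one n"
  by (simp add: orth_group_iff)

lemma orth_group_transp_mult: "u \<in> orth_group n \<Longrightarrow> mat_mult n (mat_transp n u) u = mat_one n"
  using orth_group_mult_transp [OF orth_group_transp] mat_transp_transp orth_group_ext by metis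

lemma orth_group_one: "mat_one n \<in> orth_group n"
  by (simp add: orth_group_iff mat_transp_one mat_mult_one_left)

lemma orth_group_mult:
  assumes "u \<in> orth_group n" "v \<in> orth_group n"
  shows "mat_mult n u v \<in> orth_group n"
proof -
  have "mat_mult n (mat_mult n u v) (mat_transp n (mat_mult n u v))
      = mat_mult n u (mat_mult n (mat_mult n v (mat_transp n v)) (mat_transp n u))"
    by (simp add: mat_transp_mult mat_mult_assoc)
  then show ?thesis
    using assms by (simp add: orth_group_iff [of "mat_mult n u v"] orth_group_mult_transp mat_mult_one_left)
qed

lemma orth_group_cancel_left:
  assumes "g \<in> orth_group n" "u \<in> extensional ({..<n} \<times> {..<n})"
  shows "mat_mult n (mat_transp n g) (mat_mult n g u) = u" "mat_mult n g (mat_mult n (mat_transp n g) u) = u"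
  using assms
  by (simp_all add: orth_group_transp_mult orth_group_mult_transp mat_mult_one_left flip: mat_mult_assoc)

text \<open>Rows are unit vectors. The bound is what makes monomials in the entries integrable for
  Haar measure.\<close>

lemma orth_group_abs_le_1:
  assumes "u \<in> orth_group n" "i < n" "j < n"
  shows "\<bar>u (i, j)\<bar> \<le> 1"
proof -
  have "u (i, j) * u (i, j) \<le> (\<Sum>l<n. u (i, l) * u (i, l))"
    using assms by (intro member_le_sum) auto
  then have "(u (i, j))\<^sup>2 \<le> 1"
    using assms orth_group_rows [of u n i i] by (simp add: power2_eq_square)
  then show ?thesis by (simp add: abs_square_le_1)
qed

subsection \<open>Lebesgue measure on matrices\<close>

lemma space_matrix_space: "space (matrix_space n) = extensional ({..<n} \<times> {..<n})"
  by (simp add: matrix_space_def space_PiM PiE_def)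

lemma measurable_mat_entry:
  assumes "f \<in> M \<rightarrow>\<^sub>M matrix_space n" "i < n" "j < n"
  shows "(\<lambda>x. f x (i, j)) \<in> borel_measurable M"
  using assms unfolding matrix_space_def
  by (intro measurable_compose [OF _ measurable_component_singleton, of f]) auto

lemma measurable_matrixI:
  assumes "\<And>i j. i < n \<Longrightarrow> j < n \<Longrightarrow> (\<lambda>x. f x (i, j)) \<in> borel_measurable M"
    and "\<And>x. f x \<in> extensional ({..<n} \<times> {..<n})"
  shows "f \<in> M \<rightarrow>\<^sub>M matrix_space n"
proof -
  have "f = (\<lambda>x. \<lambda>ij\<in>{..<n} \<times> {..<n}. f x ij)"
    using assms(2) by (auto simp: extensional_restrict)
  also have "\<dots> \<in> M \<rightarrow>\<^sub>M matrix_space n"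
    unfolding matrix_space_def using assms(1) by (intro measurable_restrict) auto
  finally show ?thesis .
qed

lemma measurable_mat_mult:
  assumes "f \<in> M \<rightarrow>\<^sub>M matrix_space n" "g \<in> M \<rightarrow>\<^sub>M matrix_space n"
  shows "(\<lambda>x. mat_mult n (f x) (g x)) \<in> M \<rightarrow>\<^sub>M matrix_space n"
  using assms
  by (intro measurable_matrixI)
     (auto simp: mat_mult_apply intro!: borel_measurable_sum borel_measurable_times measurable_mat_entry)

lemma measurable_mat_transp:
  assumes "f \<in> M \<rightarrow>\<^sub>M matrix_space n"
  shows "(\<lambda>x. mat_transp n (f x)) \<in> M \<rightarrow>\<^sub>M matrix_space n"
  using assms
  by (intro measurable_matrixI) (auto simp: mat_transp_apply intro!: measurable_mat_entry)

section \<open>Translation invariance of Lebesgue measure on matrices\<close>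

definition matrix_lebesgue :: "nat \<Rightarrow> (nat \<times> nat \<Rightarrow> real) measure" where
  "matrix_lebesgue n = PiM ({..<n} \<times> {..<n}) (\<lambda>_. lborel)"

definition mat_add :: "nat \<Rightarrow> (nat \<times> nat \<Rightarrow> real) \<Rightarrow> (nat \<times> nat \<Rightarrow> real) \<Rightarrow> (nat \<times> nat \<Rightarrow> real)" where
  "mat_add n x y = (\<lambda>ij\<in>{..<n} \<times> {..<n}. x ij + y ij)"

definition mat_sub :: "nat \<Rightarrow> (nat \<times> nat \<Rightarrow> real) \<Rightarrow> (nat \<times> nat \<Rightarrow> real) \<Rightarrow> (nat \<times> nat \<Rightarrow> real)" where
  "mat_sub n x y = (\<lambda>ij\<in>{..<n} \<times> {..<n}. x ij - y ij)"

lemma mat_add_ext [simp]: "mat_add n x y \<in> extensional ({..<n} \<times> {..<n})"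
  by (simp add: mat_add_def)

lemma mat_sub_ext [simp]: "mat_sub n x y \<in> extensional ({..<n} \<times> {..<n})"
  by (simp add: mat_sub_def)

lemma mat_add_apply: "i < n \<Longrightarrow> j < n \<Longrightarrow> mat_add n x y (i, j) = x (i, j) + y (i, j)"
  by (simp add: mat_add_def)

lemma mat_sub_apply: "i < n \<Longrightarrow> j < n \<Longrightarrow> mat_sub n x y (i, j) = x (i, j) - y (i, j)"
  by (simp add: mat_sub_def)

lemma mat_mult_add: "mat_mult n g (mat_add n x y) = mat_add n (mat_mult n g x) (mat_mult n g y)"
  by (rule mat_eqI [of _ n]) (simp_all add: mat_mult_apply mat_add_apply sum.distrib distrib_left)

lemma mat_mult_sub: "mat_mult n g (mat_sub n x y) = mat_sub n (mat_mult n g x) (mat_mult n g y)"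
  by (rule mat_eqI [of _ n]) (simp_all add: mat_mult_apply mat_sub_apply sum_subtractf right_diff_distrib)

lemma mat_sub_add_cancel:
  "x \<in> extensional ({..<n} \<times> {..<n}) \<Longrightarrow> mat_add n y (mat_sub n x y) = x"
  by (rule mat_eqI [of _ n]) (simp_all add: mat_add_apply mat_sub_apply)

lemma sets_matrix_lebesgue [measurable_cong]: "sets (matrix_lebesgue n) = sets (matrix_space n)"
  unfolding matrix_lebesgue_def matrix_space_def by (intro sets_PiM_cong) auto

lemma space_matrix_lebesgue: "space (matrix_lebesgue n) = extensional ({..<n} \<times> {..<n})"
  using sets_eq_imp_space_eq [OF sets_matrix_lebesgue] space_matrix_space by simp

lemma measurable_mat_add:
  assumes "f \<in> M \<rightarrow>\<^sub>M matrix_space n" "g \<in> M \<rightarrow>\<^sub>M matrix_space n"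
  shows "(\<lambda>x. mat_add n (f x) (g x)) \<in> M \<rightarrow>\<^sub>M matrix_space n"
  using assms
  by (intro measurable_matrixI)
     (auto simp: mat_add_apply intro!: borel_measurable_add measurable_mat_entry)

lemma measurable_mat_sub:
  assumes "f \<in> M \<rightarrow>\<^sub>M matrix_space n" "g \<in> M \<rightarrow>\<^sub>M matrix_space n"
  shows "(\<lambda>x. mat_sub n (f x) (g x)) \<in> M \<rightarrow>\<^sub>M matrix_space n"
  using assms
  by (intro measurable_matrixI)
     (auto simp: mat_sub_apply intro!: borel_measurable_diff measurable_mat_entry)

lemma emeasure_matrix_lebesgue_PiE:
  assumes "\<And>ij. ij \<in> {..<n} \<times> {..<n} \<Longrightarrow> A ij \<in> sets borel"
  shows "emeasure (matrix_lebesgue n) (PiE ({..<n} \<times> {..<n}) A) = (\<Prod>ij\<in>{..<n} \<times> {..<n}. emeasure lborel (A ij))"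
proof -
  interpret product_sigma_finite "\<lambda>_. lborel :: real measure" ..
  show ?thesis
    unfolding matrix_lebesgue_def using assms by (intro emeasure_PiM) auto
qed

lemma sigma_finite_matrix_lebesgue: "sigma_finite_measure (matrix_lebesgue n)"
proof -
  interpret product_sigma_finite "\<lambda>_. lborel :: real measure" ..
  show ?thesis
    unfolding matrix_lebesgue_def by (rule sigma_finite) auto
qed

lemma measurable_matrix_lebesgue:
  "measurable (matrix_lebesgue n) (matrix_lebesgue n) = measurable (matrix_space n) (matrix_space n)"
  by (rule measurable_cong_sets) (rule sets_matrix_lebesgue)+

lemma measurable_translate:
  assumes "c \<in> extensional ({..<n} \<times> {..<n})"
  shows "mat_add n c \<in> matrix_lebesgue n \<rightarrow>\<^sub>M matrix_lebesgue n"
  unfolding measurable_matrix_lebesgue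
  using assms by (intro measurable_mat_add) (auto simp: space_matrix_space)

text \<open>A product measure is determined by its values on boxes, and translation moves each side
  of a box separately, so the one-dimensional case suffices.\<close>

lemma distr_matrix_lebesgue_translate:
  assumes c: "c \<in> extensional ({..<n} \<times> {..<n})"
  shows "distr (matrix_lebesgue n) (matrix_lebesgue n) (mat_add n c) = matrix_lebesgue n"
proof -
  interpret product_sigma_finite "\<lambda>_. lborel :: real measure" ..
  note meas = measurable_translate [OF c]
  show ?thesis
    unfolding matrix_lebesgue_def
  proof (rule PiM_eqI)
    fix A :: "nat \<times> nat \<Rightarrow> real set"
    assume A: "\<And>i. i \<in> {..<n} \<times> {..<n} \<Longrightarrow> A i \<in> sets lborel"
    let ?B = "\<lambda>i. (+) (c i) -` A i"
    have B: "?B i \<in> sets borel" if "i \<in> {..<n} \<times> {..<n}" for i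
      using measurable_sets [of "(+) (c i)" "borel::real measure" borel "A i"] A [OF that] by simp
    have "mat_add n c -` PiE ({..<n} \<times> {..<n}) A \<inter> space (matrix_lebesgue n) = PiE ({..<n} \<times> {..<n}) ?B"
      by (rule set_eqI) (simp add: space_matrix_lebesgue mat_add_def PiE_iff conj_commute cong: ball_cong)
    moreover have "PiE ({..<n} \<times> {..<n}) A \<in> sets (matrix_lebesgue n)"
      unfolding matrix_lebesgue_def using A by (intro sets_PiM_I_finite) auto
    ultimately have "emeasure (distr (matrix_lebesgue n) (matrix_lebesgue n) (mat_add n c)) (PiE ({..<n} \<times> {..<n}) A)
       = emeasure (matrix_lebesgue n) (PiE ({..<n} \<times> {..<n}) ?B)"
      using meas by (simp add: emeasure_distr)
    also have "\<dots> = (\<Prod>i\<in>{..<n} \<times> {..<n}. emeasure lborel (?B i))"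
      using B by (rule emeasure_matrix_lebesgue_PiE)
    also have "\<dots> = (\<Prod>i\<in>{..<n} \<times> {..<n}. emeasure lborel (A i))"
    proof (rule prod.cong)
      fix i assume i: "i \<in> {..<n} \<times> {..<n}"
      have "emeasure lborel (A i) = emeasure (distr lborel borel ((+) (c i))) (A i)"
        by (simp add: lborel_distr_plus)
      also have "\<dots> = emeasure lborel (?B i)"
        using A [OF i] by (subst emeasure_distr) auto
      finally show "emeasure lborel (?B i) = emeasure lborel (A i)" by simp
    qed simp
    finally show "emeasure (distr (PiM ({..<n} \<times> {..<n}) (\<lambda>_. lborel)) (PiM ({..<n} \<times> {..<n}) (\<lambda>_. lborel)) (mat_add n c))
        (PiE ({..<n} \<times> {..<n}) A) = (\<Prod>i\<in>{..<n} \<times> {..<n}. emeasure lborel (A i))"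
      by (simp add: matrix_lebesgue_def)
  qed auto
qed

lemma nn_integral_matrix_lebesgue_add:
  assumes "c \<in> extensional ({..<n} \<times> {..<n})" "f \<in> borel_measurable (matrix_space n)"
  shows "(\<integral>\<^sup>+x. f (mat_add n c x) \<partial>matrix_lebesgue n) = (\<integral>\<^sup>+x. f x \<partial>matrix_lebesgue n)"
proof -
  note measurable_translate [OF assms(1)]
  moreover have "f \<in> borel_measurable (matrix_lebesgue n)"
    using assms by (simp cong: measurable_cong_sets add: sets_matrix_lebesgue)
  ultimately have "(\<integral>\<^sup>+x. f (mat_add n c x) \<partial>matrix_lebesgue n)
      = (\<integral>\<^sup>+x. f x \<partial>distr (matrix_lebesgue n) (matrix_lebesgue n) (mat_add n c))"
    by (subst nn_integral_distr) auto
  then show ?thesis using assms by (simp add: distr_matrix_lebesgue_translate)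
qed

lemma nn_integral_matrix_lebesgue_sub:
  assumes "c \<in> extensional ({..<n} \<times> {..<n})" "f \<in> borel_measurable (matrix_space n)"
  shows "(\<integral>\<^sup>+x. f (mat_sub n x c) \<partial>matrix_lebesgue n) = (\<integral>\<^sup>+x. f x \<partial>matrix_lebesgue n)"
proof -
  let ?c = "\<lambda>ij\<in>{..<n} \<times> {..<n}. - c ij"
  have "mat_sub n x c = mat_add n ?c x" for x
    by (rule mat_eqI [of _ n]) (simp_all add: mat_add_apply mat_sub_apply)
  then show ?thesis
    using nn_integral_matrix_lebesgue_add [of ?c n f] assms by simp
qed

section \<open>Invariance of Lebesgue measure under orthogonal matrices\<close>

lemma orth_group_isometry:
  assumes "g \<in> orth_group n"
  shows "(\<Sum>i<n. (\<Sum>l<n. g (i, l) * v l) * (\<Sum>l<n. g (i, l) * w l)) = (\<Sum>i<n. v i * w i)"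
proof -
  have "(\<Sum>i<n. (\<Sum>l<n. g (i, l) * v l) * (\<Sum>l<n. g (i, l) * w l))
      = (\<Sum>i<n. \<Sum>l<n. \<Sum>m<n. v l * w m * (g (i, l) * g (i, m)))"
    by (simp add: sum_product mult_ac)
  also have "\<dots> = (\<Sum>l<n. \<Sum>m<n. \<Sum>i<n. v l * w m * (g (i, l) * g (i, m)))"
    by (subst sum.swap) (intro sum.cong refl sum.swap)
  also have "\<dots> = (\<Sum>l<n. \<Sum>m<n. v l * w m * (if l = m then 1 else 0))"
    using assms by (intro sum.cong refl) (simp add: orth_group_columns flip: sum_distrib_left)
  also have "\<dots> = (\<Sum>l<n. v l * w l)"
    by (simp add: if_distrib cong: if_cong)
  finally show ?thesis .
qed

text \<open>The ball of radius \<open>2 * n\<close> for the Frobenius norm, summed column by column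
  because left multiplication by an orthogonal matrix is an isometry on each column. The radius
  admits all matrices whose \<open>n * n\<close> entries are at most 2 in absolute value, in
  particular those of \<open>identity_box\<close>.\<close>

definition matrix_ball :: "nat \<Rightarrow> (nat \<times> nat \<Rightarrow> real) set" where
  "matrix_ball n = {x \<in> extensional ({..<n} \<times> {..<n}). (\<Sum>j<n. \<Sum>i<n. x (i, j) * x (i, j)) \<le> 4 * (real n)\<^sup>2}"

lemma matrix_ball_mult_iff:
  assumes "g \<in> orth_group n" "x \<in> extensional ({..<n} \<times> {..<n})"
  shows "mat_mult n g x \<in> matrix_ball n \<longleftrightarrow> x \<in> matrix_ball n"
proof -
  have "(\<Sum>j<n. \<Sum>i<n. mat_mult n g x (i, j) * mat_mult n g x (i, j)) = (\<Sum>j<n. \<Sum>i<n. x (i, j) * x (i, j))"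
    proof (rule sum.cong [OF refl])
    fix j assume "j \<in> {..<n}"
    then show "(\<Sum>i<n. mat_mult n g x (i, j) * mat_mult n g x (i, j)) = (\<Sum>i<n. x (i, j) * x (i, j))"
      using orth_group_isometry [OF assms(1), of "\<lambda>l. x (l, j)" "\<lambda>l. x (l, j)"] by (simp add: mat_mult_apply)
  qed
  then show ?thesis using assms by (simp add: matrix_ball_def)
qed

lemma matrix_ball_sub_commute: "mat_sub n x y \<in> matrix_ball n \<longleftrightarrow> mat_sub n y x \<in> matrix_ball n"
proof -
  have "(\<Sum>j<n. \<Sum>i<n. mat_sub n x y (i, j) * mat_sub n x y (i, j))
      = (\<Sum>j<n. \<Sum>i<n. mat_sub n y x (i, j) * mat_sub n y x (i, j))"
    by (intro sum.cong refl) (simp add: mat_sub_apply algebra_simps)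
  then show ?thesis by (simp add: matrix_ball_def)
qed

lemma sets_matrix_ball [measurable]: "matrix_ball n \<in> sets (matrix_space n)"
proof -
  have [measurable]: "(\<lambda>x. x (i, j)) \<in> borel_measurable (matrix_space n)" if "i < n" "j < n" for i j
    using that by (intro measurable_mat_entry) auto
  have "matrix_ball n = {x \<in> space (matrix_space n). (\<Sum>j<n. \<Sum>i<n. x (i, j) * x (i, j)) \<le> 4 * (real n)\<^sup>2}"
    by (simp add: matrix_ball_def space_matrix_space)
  also have "\<dots> \<in> sets (matrix_space n)"
    by (intro borel_measurable_le borel_measurable_sum borel_measurable_times) auto
  finally show ?thesis .
qed

text \<open>The half-width \<open>1 / n\<close> makes the \<open>n\<close> perturbations in a row
  add up to less than 1, the diagonal entry of the identity. The box is open and witnesses that the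
  ball and the set of regular matrices in it have positive measure.\<close>

definition identity_box :: "nat \<Rightarrow> (nat \<times> nat \<Rightarrow> real) set" where
  "identity_box n = (\<Pi>\<^sub>E ij\<in>{..<n} \<times> {..<n}. {mat_one n ij - 1 / real n<..<mat_one n ij + 1 / real n})"

lemma emeasure_identity_box:
  assumes "n > 0"
  shows "emeasure (matrix_lebesgue n) (identity_box n) > 0"
proof -
  have "emeasure lborel {a - 1 / real n<..<a + 1 / real n} = ennreal (2 / real n)" for a
    by (subst emeasure_lborel_Ioo) (simp_all add: field_simps)
  then have "emeasure (matrix_lebesgue n) (identity_box n) = ennreal (2 / real n) ^ card ({..<n} \<times> {..<n})"
    unfolding identity_box_def by (subst emeasure_matrix_lebesgue_PiE) simp_all
  also have "\<dots> = ennreal ((2 / real n) ^ card ({..<n} \<times> {..<n}))"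
    by (simp add: ennreal_power)
  also have "\<dots> > 0"
    using assms by (simp only: ennreal_less_zero_iff) (intro zero_less_power, simp)
  finally show ?thesis .
qed

lemma identity_box_subset_ball: "identity_box n \<subseteq> matrix_ball n"
proof
  fix x assume x: "x \<in> identity_box n"
  have "x (i, j) * x (i, j) \<le> 4" if ij: "i < n" "j < n" for i j
  proof -
    have "x (i, j) \<in> {mat_one n (i, j) - 1 / real n<..<mat_one n (i, j) + 1 / real n}"
      using x ij unfolding identity_box_def by (auto simp: PiE_iff)
    moreover define e where "e = 1 / real n"
    moreover have "0 < e" "e \<le> 1" using ij by (auto simp: e_def)
    ultimately have "\<bar>x (i, j)\<bar> \<le> 2"
      using ij by (cases "i = j") (simp_all add: mat_one_apply abs_le_iff del: divide_le_eq_1_pos)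
    then have "\<bar>x (i, j)\<bar> * \<bar>x (i, j)\<bar> \<le> 2 * 2" by (intro mult_mono) auto
    then show ?thesis by simp
  qed
  then have "(\<Sum>j<n. \<Sum>i<n. x (i, j) * x (i, j)) \<le> (\<Sum>j<n. \<Sum>i<n. 4)"
    by (intro sum_mono) auto
  then show "x \<in> matrix_ball n"
    using x by (simp add: matrix_ball_def identity_box_def PiE_iff power2_eq_square)
qed

lemma emeasure_matrix_ball_finite: "emeasure (matrix_lebesgue n) (matrix_ball n) < \<infinity>"
proof -
  let ?B = "\<Pi>\<^sub>E ij\<in>{..<n} \<times> {..<n}. {- (2 * real n)..2 * real n}"
  have "matrix_ball n \<subseteq> ?B"
  proof
    fix x assume x: "x \<in> matrix_ball n"
    have "\<bar>x (i, j)\<bar> \<le> 2 * real n" if ij: "i < n" "j < n" for i j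
    proof -
      have "x (i, j) * x (i, j) \<le> (\<Sum>i<n. x (i, j) * x (i, j))"
        using ij by (intro member_le_sum) auto
      also have "\<dots> \<le> (\<Sum>j<n. \<Sum>i<n. x (i, j) * x (i, j))"
        using ij by (intro member_le_sum [of j _ "\<lambda>j. \<Sum>i<n. x (i, j) * x (i, j)"]) (auto intro: sum_nonneg)
      also have "\<dots> \<le> (2 * real n)\<^sup>2"
        using x by (simp add: matrix_ball_def power2_eq_square)
      finally have "(x (i, j))\<^sup>2 \<le> (2 * real n)\<^sup>2" by (simp only: power2_eq_square)
      then show ?thesis by (simp only: abs_le_square_iff [symmetric])
    qed
    then have "x (i, j) \<in> {- (2 * real n)..2 * real n}" if "i < n" "j < n" for i j
      using that by (simp add: abs_le_iff minus_le_iff)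
    then show "x \<in> ?B"
      using x by (auto simp only: matrix_ball_def PiE_iff mem_Collect_eq lessThan_iff mem_Sigma_iff)
  qed
  moreover have "?B \<in> sets (matrix_lebesgue n)"
    unfolding matrix_lebesgue_def by (intro sets_PiM_I_finite) auto
  ultimately have "emeasure (matrix_lebesgue n) (matrix_ball n) \<le> emeasure (matrix_lebesgue n) ?B"
    by (intro emeasure_mono)
  also have "\<dots> < \<infinity>"
    by (subst emeasure_matrix_lebesgue_PiE) (auto simp: power_less_top_ennreal)
  finally show ?thesis .
qed

text \<open>Translating \<open>x\<close> by \<open>g\<^sup>T y\<close> and \<open>y\<close> by \<open>- g x\<close> in
  \<open>\<integral>\<integral> f (g x) h y dx dy\<close>, with \<open>h\<close> the indicator of the invariant ball, turns it into
  \<open>\<integral>\<integral> f y h (y - g x) dx dy = \<integral> f \<cdot> \<integral> h\<close>.\<close>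
lemma nn_integral_matrix_lebesgue_mult:
  assumes n: "n > 0" and g: "g \<in> orth_group n" and f [measurable]: "f \<in> borel_measurable (matrix_space n)"
  shows "(\<integral>\<^sup>+x. f (mat_mult n g x) \<partial>matrix_lebesgue n) = (\<integral>\<^sup>+x. f x \<partial>matrix_lebesgue n)"
proof -
  let ?L = "matrix_lebesgue n"
  interpret L: sigma_finite_measure ?L by (rule sigma_finite_matrix_lebesgue)
  interpret LL: pair_sigma_finite ?L ?L ..
  define h :: "(nat \<times> nat \<Rightarrow> real) \<Rightarrow> ennreal" where "h = indicator (matrix_ball n)"
  define H where "H = (\<integral>\<^sup>+x. h x \<partial>?L)"
  have h [measurable]: "h \<in> borel_measurable (matrix_space n)"
    unfolding h_def by measurable
  note ms = measurable_mat_mult [measurable] measurable_mat_add [measurable] measurable_mat_sub [measurable]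
  have gc [measurable]: "(\<lambda>_. g) \<in> M \<rightarrow>\<^sub>M matrix_space n" for M :: "'z measure"
    using g by (simp add: space_matrix_space orth_group_ext)
  have gTc [measurable]: "(\<lambda>_. mat_transp n g) \<in> M \<rightarrow>\<^sub>M matrix_space n" for M :: "'z measure"
    by (simp add: space_matrix_space)
  have id [measurable]: "(\<lambda>x. x) \<in> ?L \<rightarrow>\<^sub>M matrix_space n"
    by (simp add: measurable_ident_sets sets_matrix_lebesgue)
  have const: "(\<lambda>_. c) \<in> M \<rightarrow>\<^sub>M matrix_space n" if "c \<in> extensional ({..<n} \<times> {..<n})" for c and M :: "'z measure"
    using that by (simp add: space_matrix_space)
  have H: "H = emeasure ?L (matrix_ball n)"
    unfolding H_def h_def by (subst nn_integral_indicator) (auto simp: sets_matrix_lebesgue)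
  \<comment> \<open>The common factor \<open>H\<close> is cancelled at the end, so it must be
    neither zero nor infinite.\<close>
  have H0: "H \<noteq> 0"
  proof -
    have "emeasure ?L (identity_box n) \<le> H"
      unfolding H by (intro emeasure_mono identity_box_subset_ball) (simp add: sets_matrix_lebesgue)
    then show ?thesis using emeasure_identity_box [OF n] by auto
  qed
  have Hinf: "H \<noteq> \<top>" using emeasure_matrix_ball_finite [of n] by (simp add: H)
  have "(\<integral>\<^sup>+x. f (mat_mult n g x) \<partial>?L) * H = (\<integral>\<^sup>+y. (\<integral>\<^sup>+x. f (mat_mult n g x) \<partial>?L) * h y \<partial>?L)"
    unfolding H_def by (rule nn_integral_cmult [symmetric]) measurable
  also have "\<dots> = (\<integral>\<^sup>+y. \<integral>\<^sup>+x. f (mat_add n (mat_mult n g x) y) * h y \<partial>?L \<partial>?L)"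
  proof (rule nn_integral_cong)
    fix y assume "y \<in> space ?L"
    then have y: "y \<in> extensional ({..<n} \<times> {..<n})" by (simp add: space_matrix_lebesgue)
    note [measurable] = const [OF y]
    have "(\<integral>\<^sup>+x. f (mat_mult n g x) \<partial>?L) = (\<integral>\<^sup>+x. f (mat_mult n g (mat_add n (mat_mult n (mat_transp n g) y) x)) \<partial>?L)"
      by (rule nn_integral_matrix_lebesgue_add [symmetric]) (simp, measurable)
    also have "\<dots> = (\<integral>\<^sup>+x. f (mat_add n (mat_mult n g x) y) \<partial>?L)"
      using g y by (intro nn_integral_cong arg_cong [of _ _ f])
        (simp add: mat_mult_add orth_group_cancel_left, simp add: mat_add_def add.commute)
    finally show "(\<integral>\<^sup>+x. f (mat_mult n g x) \<partial>?L) * h y = (\<integral>\<^sup>+x. f (mat_add n (mat_mult n g x) y) * h y \<partial>?L)"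
      by (simp add: nn_integral_multc)
  qed
  also have "\<dots> = (\<integral>\<^sup>+x. \<integral>\<^sup>+y. f (mat_add n (mat_mult n g x) y) * h y \<partial>?L \<partial>?L)"
    by (rule LL.Fubini') measurable
  also have "\<dots> = (\<integral>\<^sup>+x. \<integral>\<^sup>+y. f y * h (mat_sub n y (mat_mult n g x)) \<partial>?L \<partial>?L)"
  proof (rule nn_integral_cong)
    fix x assume "x \<in> space ?L"
    then have x: "x \<in> extensional ({..<n} \<times> {..<n})" by (simp add: space_matrix_lebesgue)
    note [measurable] = const [OF x]
    have "(\<integral>\<^sup>+y. f (mat_add n (mat_mult n g x) y) * h y \<partial>?L)
        = (\<integral>\<^sup>+y. f (mat_add n (mat_mult n g x) (mat_sub n y (mat_mult n g x))) * h (mat_sub n y (mat_mult n g x)) \<partial>?L)"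
      by (rule nn_integral_matrix_lebesgue_sub [symmetric]) (simp, measurable)
    also have "\<dots> = (\<integral>\<^sup>+y. f y * h (mat_sub n y (mat_mult n g x)) \<partial>?L)"
      by (intro nn_integral_cong) (simp add: mat_sub_add_cancel space_matrix_lebesgue)
    finally show "(\<integral>\<^sup>+y. f (mat_add n (mat_mult n g x) y) * h y \<partial>?L)
        = (\<integral>\<^sup>+y. f y * h (mat_sub n y (mat_mult n g x)) \<partial>?L)" .
  qed
  also have "\<dots> = (\<integral>\<^sup>+y. \<integral>\<^sup>+x. f y * h (mat_sub n y (mat_mult n g x)) \<partial>?L \<partial>?L)"
    by (rule LL.Fubini' [symmetric]) measurable
  also have "\<dots> = (\<integral>\<^sup>+y. f y * H \<partial>?L)"
  proof (rule nn_integral_cong)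
    fix y assume "y \<in> space ?L"
    then have y: "y \<in> extensional ({..<n} \<times> {..<n})" by (simp add: space_matrix_lebesgue)
    note [measurable] = const [OF y]
    \<comment> \<open>The ball is invariant under \<open>g\<close> and under change of sign, so
      \<open>y - g x\<close> may be replaced by \<open>x - g^T y\<close>, which is a mere
      translation in \<open>x\<close>.\<close>
    have "h (mat_sub n y (mat_mult n g x)) = h (mat_sub n x (mat_mult n (mat_transp n g) y))"
      if x: "x \<in> extensional ({..<n} \<times> {..<n})" for x
    proof -
      have "mat_mult n g (mat_sub n (mat_mult n (mat_transp n g) y) x) = mat_sub n y (mat_mult n g x)"
        using g y by (simp add: mat_mult_sub orth_group_cancel_left)
      then have "mat_sub n y (mat_mult n g x) \<in> matrix_ball n \<longleftrightarrow> mat_sub n (mat_mult n (mat_transp n g) y) x \<in> matrix_ball n"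
        using matrix_ball_mult_iff [OF g, of "mat_sub n (mat_mult n (mat_transp n g) y) x"] by simp
      then show ?thesis
        using matrix_ball_sub_commute [of n x] by (simp add: h_def indicator_def)
    qed
    then have "(\<integral>\<^sup>+x. h (mat_sub n y (mat_mult n g x)) \<partial>?L)
        = (\<integral>\<^sup>+x. h (mat_sub n x (mat_mult n (mat_transp n g) y)) \<partial>?L)"
      by (intro nn_integral_cong) (simp add: space_matrix_lebesgue)
    also have "\<dots> = H"
      unfolding H_def by (rule nn_integral_matrix_lebesgue_sub) (simp, measurable)
    finally show "(\<integral>\<^sup>+x. f y * h (mat_sub n y (mat_mult n g x)) \<partial>?L) = f y * H"
      by (subst nn_integral_cmult) auto
  qed
  also have "\<dots> = (\<integral>\<^sup>+y. f y \<partial>?L) * H"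
    by (rule nn_integral_multc) measurable
  finally show ?thesis
    using H0 Hinf by (simp add: ennreal_mult_cancel_left mult.commute [of _ H])
qed

subsection \<open>Gram--Schmidt orthonormalisation of the columns\<close>

definition dot :: "nat \<Rightarrow> (nat \<Rightarrow> real) \<Rightarrow> (nat \<Rightarrow> real) \<Rightarrow> real" where
  "dot n v w = (\<Sum>i<n. v i * w i)"

context
  notes sum.cong [fundef_cong]
begin

text \<open>The congruence rule for sums shows the termination proof that the recursive calls
  satisfy \<open>l < j\<close>. Where the residual has norm zero, division by zero makes the vector
  zero, so the recursion is total.\<close>

fun gs_vec :: "nat \<Rightarrow> (nat \<times> nat \<Rightarrow> real) \<Rightarrow> nat \<Rightarrow> nat \<Rightarrow> real" where
  "gs_vec n x j = (let r = (\<lambda>i. x (i, j) - (\<Sum>l<j. dot n (\<lambda>i. x (i, j)) (gs_vec n x l) * gs_vec n x l i))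
     in (\<lambda>i. r i / sqrt (dot n r r)))"

end

declare gs_vec.simps [simp del]

definition gs_residual :: "nat \<Rightarrow> (nat \<times> nat \<Rightarrow> real) \<Rightarrow> nat \<Rightarrow> nat \<Rightarrow> real" where
  "gs_residual n x j i = x (i, j) - (\<Sum>l<j. dot n (\<lambda>i. x (i, j)) (gs_vec n x l) * gs_vec n x l i)"

lemma gs_vec_eq: "gs_vec n x j i = gs_residual n x j i / sqrt (dot n (gs_residual n x j) (gs_residual n x j))"
  by (subst gs_vec.simps) (simp add: Let_def gs_residual_def [abs_def])

text \<open>Nonzero residuals express that the columns are linearly independent, in a form that is
  visibly measurable and, being about inner products, invariant under left multiplication by
  orthogonal matrices.\<close>

definition gs_regular :: "nat \<Rightarrow> (nat \<times> nat \<Rightarrow> real) set" where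
  "gs_regular n = {x \<in> extensional ({..<n} \<times> {..<n}). \<forall>j<n. dot n (gs_residual n x j) (gs_residual n x j) \<noteq> 0}"

text \<open>The default value keeps the map inside the orthogonal group everywhere. It is not
  equivariant, which is why Haar measure is built from regular matrices.\<close>

definition gs_matrix :: "nat \<Rightarrow> (nat \<times> nat \<Rightarrow> real) \<Rightarrow> nat \<times> nat \<Rightarrow> real" where
  "gs_matrix n x = (if x \<in> gs_regular n then (\<lambda>ij\<in>{..<n} \<times> {..<n}. gs_vec n x (snd ij) (fst ij)) else mat_one n)"

lemma dot_commute: "dot n v w = dot n w v"
  by (simp add: dot_def mult.commute)

lemma dot_self_nonneg: "dot n v v \<ge> 0"
  by (simp add: dot_def sum_nonneg)

lemma gs_vec_orthonormal:
  assumes x: "x \<in> gs_regular n" and j: "j < n" and l: "l \<le> j"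
  shows "dot n (gs_vec n x l) (gs_vec n x j) = (if l = j then 1 else 0)"
  using j l
proof (induction j arbitrary: l rule: less_induct)
  case (less j)
  let ?r = "gs_residual n x j" let ?q = "gs_vec n x"
  have r: "dot n ?r ?r > 0"
    using x less.prems dot_self_nonneg [of n ?r] by (auto simp: gs_regular_def less_le)
  show ?case
  proof (cases "l = j")
    case True
    have "dot n (?q j) (?q j) = dot n ?r ?r / (sqrt (dot n ?r ?r) * sqrt (dot n ?r ?r))"
      unfolding gs_vec_eq [abs_def] dot_def [of n "\<lambda>i. _ i / _"] by (simp add: sum_divide_distrib dot_def)
    then show ?thesis using r True by simp
  next
    case False
    then have lj: "l < j" using less.prems by simp
    have on: "dot n (?q l) (?q m) = (if l = m then 1 else 0)" if "m < j" for m
      using less.IH [of m l] less.IH [of l m] that lj less.prems dot_commute [of n "?q l" "?q m"]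
      by (cases "l \<le> m") auto
    have "dot n (?q l) ?r = dot n (?q l) (\<lambda>i. x (i, j)) - (\<Sum>i<n. \<Sum>m<j. dot n (\<lambda>i. x (i, j)) (?q m) * (?q l i * ?q m i))"
      unfolding dot_def [of n "?q l"] gs_residual_def
      by (simp add: right_diff_distrib sum_subtractf sum_distrib_left mult_ac)
    also have "(\<Sum>i<n. \<Sum>m<j. dot n (\<lambda>i. x (i, j)) (?q m) * (?q l i * ?q m i))
        = (\<Sum>m<j. dot n (\<lambda>i. x (i, j)) (?q m) * dot n (?q l) (?q m))"
      unfolding dot_def [of n "?q l"] by (subst sum.swap) (simp add: sum_distrib_left)
    also have "\<dots> = (\<Sum>m<j. dot n (\<lambda>i. x (i, j)) (?q m) * (if l = m then 1 else 0))"
      using on by (intro sum.cong refl) simp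
    also have "\<dots> = dot n (\<lambda>i. x (i, j)) (?q l)"
      using lj by (simp add: if_distrib cong: if_cong)
    finally have "dot n (?q l) ?r = 0" by (simp add: dot_commute)
    moreover have "dot n (?q l) (?q j) = dot n (?q l) ?r / sqrt (dot n ?r ?r)"
      unfolding gs_vec_eq [of n x j, abs_def] dot_def [of n "?q l"] by (simp add: sum_divide_distrib)
    ultimately show ?thesis using False by simp
  qed
qed

lemma gs_matrix_orth: "gs_matrix n x \<in> orth_group n"
proof (cases "x \<in> gs_regular n")
  case True
  have "dot n (gs_vec n x l) (gs_vec n x j) = (if l = j then 1 else 0)" if "l < n" "j < n" for l j
  proof (cases "l \<le> j")
    case le: True
    show ?thesis using that le by (intro gs_vec_orthonormal [OF True])
  next
    case False
    then show ?thesis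
      using gs_vec_orthonormal [OF True, of l j] that by (subst dot_commute) simp
  qed
  then have "mat_transp n (gs_matrix n x) \<in> orth_group n"
    using True by (simp add: orth_group_def mat_transp_apply gs_matrix_def dot_def)
  then show ?thesis
    using True by (simp add: orth_group_transp_iff gs_matrix_def)
next
  case False
  then show ?thesis by (simp add: gs_matrix_def orth_group_one)
qed

lemma dot_orth_mult:
  assumes g: "g \<in> orth_group n"
    and "\<And>i. i < n \<Longrightarrow> v' i = (\<Sum>m<n. g (i, m) * v m)" "\<And>i. i < n \<Longrightarrow> w' i = (\<Sum>m<n. g (i, m) * w m)"
  shows "dot n v' w' = dot n v w"
  using orth_group_isometry [OF g, of v w] assms(2,3) by (simp add: dot_def)

text \<open>All coefficients of the recursion are inner products of columns and hence unchanged by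
  \<open>g\<close>. Gram--Schmidt therefore commutes with left multiplication, and this equivariance
  is what carries invariance from Lebesgue measure to its image.\<close>

lemma gs_mult:
  assumes g: "g \<in> orth_group n" and j: "j < n"
  shows "\<forall>i<n. gs_residual n (mat_mult n g x) j i = (\<Sum>m<n. g (i, m) * gs_residual n x j m) \<and>
    gs_vec n (mat_mult n g x) j i = (\<Sum>m<n. g (i, m) * gs_vec n x j m)"
  using j
proof (induction j rule: less_induct)
  case (less j)
  let ?y = "mat_mult n g x"
  have dt: "dot n (\<lambda>i. ?y (i, j)) (gs_vec n ?y l) = dot n (\<lambda>i. x (i, j)) (gs_vec n x l)" if "l < j" for l
    using that less.prems by (intro dot_orth_mult [OF g]) (auto simp: mat_mult_apply less.IH)
  have res: "gs_residual n ?y j i = (\<Sum>m<n. g (i, m) * gs_residual n x j m)" if i: "i < n" for i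
  proof -
    have "gs_residual n ?y j i = (\<Sum>m<n. g (i, m) * x (m, j))
        - (\<Sum>l<j. \<Sum>m<n. g (i, m) * (dot n (\<lambda>i. x (i, j)) (gs_vec n x l) * gs_vec n x l m))"
      unfolding gs_residual_def using i less.prems
      by (simp add: mat_mult_apply dt less.IH sum_distrib_left mult_ac)
    also have "(\<Sum>l<j. \<Sum>m<n. g (i, m) * (dot n (\<lambda>i. x (i, j)) (gs_vec n x l) * gs_vec n x l m))
        = (\<Sum>m<n. \<Sum>l<j. g (i, m) * (dot n (\<lambda>i. x (i, j)) (gs_vec n x l) * gs_vec n x l m))"
      by (rule sum.swap)
    finally show ?thesis
      by (simp add: gs_residual_def right_diff_distrib sum_subtractf sum_distrib_left)
  qed
  then have "dot n (gs_residual n ?y j) (gs_residual n ?y j) = dot n (gs_residual n x j) (gs_residual n x j)"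
    using res by (intro dot_orth_mult [OF g]) auto
  then show ?case by (simp add: gs_vec_eq res sum_divide_distrib)
qed

lemmas gs_residual_mult = gs_mult [rule_format, THEN conjunct1]
  and gs_vec_mult = gs_mult [rule_format, THEN conjunct2]

lemma gs_regular_mult_iff:
  assumes "g \<in> orth_group n" "x \<in> extensional ({..<n} \<times> {..<n})"
  shows "mat_mult n g x \<in> gs_regular n \<longleftrightarrow> x \<in> gs_regular n"
proof -
  have "dot n (gs_residual n (mat_mult n g x) j) (gs_residual n (mat_mult n g x) j)
      = dot n (gs_residual n x j) (gs_residual n x j)" if "j < n" for j
    using assms gs_residual_mult [OF assms(1) that] by (intro dot_orth_mult) auto
  then show ?thesis using assms(2) by (simp add: gs_regular_def)
qed

lemma gs_matrix_mult:
  assumes "g \<in> orth_group n" "x \<in> gs_regular n"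
  shows "gs_matrix n (mat_mult n g x) = mat_mult n g (gs_matrix n x)"
proof -
  have "mat_mult n g x \<in> gs_regular n"
    using assms gs_regular_mult_iff by (auto simp: gs_regular_def)
  then show ?thesis
    using assms by (intro mat_eqI [of _ n]) (simp_all add: gs_matrix_def mat_mult_apply gs_vec_mult)
qed

lemma measurable_gs:
  assumes "j < n"
  shows "\<forall>i<n. (\<lambda>x. gs_residual n x j i) \<in> borel_measurable (matrix_space n) \<and>
    (\<lambda>x. gs_vec n x j i) \<in> borel_measurable (matrix_space n)"
  using assms
proof (induction j rule: less_induct)
  case (less j)
  have res: "(\<lambda>x. gs_residual n x j i) \<in> borel_measurable (matrix_space n)" if "i < n" for i
  proof -
    have "(\<lambda>x. x (i, j)) \<in> borel_measurable (matrix_space n)" if "i < n" for i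
      using that less.prems by (intro measurable_mat_entry) auto
    then show ?thesis
      unfolding gs_residual_def dot_def using that less.prems less.IH
      by (intro borel_measurable_diff borel_measurable_sum borel_measurable_times) auto
  qed
  have [measurable]: "(\<lambda>x. dot n (gs_residual n x j) (gs_residual n x j)) \<in> borel_measurable (matrix_space n)"
    unfolding dot_def using res by (intro borel_measurable_sum borel_measurable_times) auto
  have "(\<lambda>x. gs_vec n x j i) \<in> borel_measurable (matrix_space n)" if "i < n" for i
    unfolding gs_vec_eq using res [OF that] by measurable
  with res show ?case by blast
qed

lemmas measurable_gs_residual = measurable_gs [rule_format, THEN conjunct1]
  and measurable_gs_vec = measurable_gs [rule_format, THEN conjunct2]

lemma sets_gs_regular: "gs_regular n \<in> sets (matrix_space n)"
proof -
  have "{x \<in> space (matrix_space n). dot n (gs_residual n x j) (gs_residual n x j) \<noteq> 0} \<in> sets (matrix_space n)"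
    if "j < n" for j
  proof -
    have [measurable]: "(\<lambda>x. dot n (gs_residual n x j) (gs_residual n x j)) \<in> borel_measurable (matrix_space n)"
      unfolding dot_def using measurable_gs_residual that by (intro borel_measurable_sum borel_measurable_times) auto
    show ?thesis by measurable
  qed
  then have "{x \<in> space (matrix_space n). \<forall>j\<in>{..<n}. dot n (gs_residual n x j) (gs_residual n x j) \<noteq> 0} \<in> sets (matrix_space n)"
    by (intro sets.sets_Collect_finite_All) auto
  moreover have "gs_regular n = {x \<in> space (matrix_space n). \<forall>j\<in>{..<n}. dot n (gs_residual n x j) (gs_residual n x j) \<noteq> 0}"
    unfolding gs_regular_def space_matrix_space by (simp only: Ball_def lessThan_iff)
  ultimately show ?thesis by simp
qed

lemma measurable_gs_matrix: "gs_matrix n \<in> matrix_space n \<rightarrow>\<^sub>M matrix_space n"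
proof (rule measurable_matrixI)
  fix i j assume ij: "i < n" "j < n"
  have "(\<lambda>x. if x \<in> gs_regular n then gs_vec n x j i else mat_one n (i, j)) \<in> borel_measurable (matrix_space n)"
    using ij sets_gs_regular by (intro measurable_If_set measurable_gs_vec) (auto simp: sets.Int_space_eq1)
  then show "(\<lambda>x. gs_matrix n x (i, j)) \<in> borel_measurable (matrix_space n)"
    using ij by (simp add: gs_matrix_def if_distrib [of "\<lambda>f. f _"] cong: if_cong)
qed (simp add: gs_matrix_def)

text \<open>The residual is column \<open>j\<close> plus a combination of earlier columns. Because
  the coefficient at \<open>j\<close> is 1, a vanishing residual yields a nonzero vector in the
  kernel of the matrix.\<close>

lemma gs_vec_span: "\<exists>c. (\<forall>m>j. c m = 0) \<and> (\<forall>i. gs_vec n x j i = (\<Sum>m\<le>j. c m * x (i, m)))"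
  and gs_residual_span: "\<exists>c. c j = 1 \<and> (\<forall>m>j. c m = 0) \<and> (\<forall>i. gs_residual n x j i = (\<Sum>m\<le>j. c m * x (i, m)))"
proof (induction j rule: less_induct)
  case (less j)
  have "\<exists>c. \<forall>l<j. (\<forall>m>l. c l m = 0) \<and> (\<forall>i. gs_vec n x l i = (\<Sum>m\<le>l. c l m * x (i, m)))"
    using less.IH(1) by metis
  then obtain c where c0: "\<And>l m. l < j \<Longrightarrow> m > l \<Longrightarrow> c l m = 0"
    and c: "\<And>l i. l < j \<Longrightarrow> gs_vec n x l i = (\<Sum>m\<le>l. c l m * x (i, m))" by blast
  have c': "gs_vec n x l i = (\<Sum>m<j. c l m * x (i, m))" if "l < j" for l i
    unfolding c [OF that] using that by (intro sum.mono_neutral_left) (auto simp: c0)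
  define d where "d m = (if m = j then 1 else if m > j then 0 else - (\<Sum>l<j. dot n (\<lambda>i. x (i, j)) (gs_vec n x l) * c l m))" for m
  have d: "gs_residual n x j i = (\<Sum>m\<le>j. d m * x (i, m))" for i
  proof -
    have "(\<Sum>m\<le>j. d m * x (i, m)) = x (i, j) + (\<Sum>m<j. d m * x (i, m))"
      by (simp add: lessThan_Suc_atMost [symmetric] d_def)
    also have "(\<Sum>m<j. d m * x (i, m)) = - (\<Sum>m<j. \<Sum>l<j. dot n (\<lambda>i. x (i, j)) (gs_vec n x l) * c l m * x (i, m))"
      by (simp add: d_def sum_distrib_right sum_negf)
    also have "(\<Sum>m<j. \<Sum>l<j. dot n (\<lambda>i. x (i, j)) (gs_vec n x l) * c l m * x (i, m))
       = (\<Sum>l<j. dot n (\<lambda>i. x (i, j)) (gs_vec n x l) * gs_vec n x l i)"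
      by (subst sum.swap) (simp add: c' sum_distrib_left mult.assoc)
    finally show ?thesis by (simp add: gs_residual_def)
  qed
  {
    case 2
    show ?case using d by (intro exI [of _ d]) (simp add: d_def)
  next
    case 1
    let ?s = "sqrt (dot n (gs_residual n x j) (gs_residual n x j))"
    show ?case
      by (intro exI [of _ "\<lambda>m. d m / ?s"]) (simp add: d_def gs_vec_eq d sum_divide_distrib)
  }
qed

text \<open>Matrices in the box are strictly diagonally dominant, hence injective.\<close>
lemma identity_box_subset_regular:
  assumes "n > 0"
  shows "identity_box n \<subseteq> gs_regular n"
proof
  fix x assume x: "x \<in> identity_box n"
  have near: "\<bar>mat_one n (i, m) - x (i, m)\<bar> < 1 / real n" if "i < n" "m < n" for i m
  proof -
    have "x (i, m) \<in> {mat_one n (i, m) - 1 / real n<..<mat_one n (i, m) + 1 / real n}"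
      using x that unfolding identity_box_def by (auto simp: PiE_iff)
    then show ?thesis unfolding greaterThanLessThan_iff abs_less_iff by linarith
  qed
  have "dot n (gs_residual n x j) (gs_residual n x j) \<noteq> 0" if j: "j < n" for j
  proof
    assume 0: "dot n (gs_residual n x j) (gs_residual n x j) = 0"
    have res0: "gs_residual n x j i = 0" if "i < n" for i
      using 0 that unfolding dot_def by (subst (asm) sum_nonneg_eq_0_iff) auto
    obtain c where cj: "c j = 1" and c0: "\<And>m. m > j \<Longrightarrow> c m = 0"
      and c: "\<And>i. gs_residual n x j i = (\<Sum>m\<le>j. c m * x (i, m))" using gs_residual_span by blast
    have ker: "(\<Sum>m<n. c m * x (i, m)) = 0" if "i < n" for i
    proof -
      have "(\<Sum>m\<le>j. c m * x (i, m)) = (\<Sum>m<n. c m * x (i, m))"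
        using j by (intro sum.mono_neutral_left) (auto simp: c0)
      then show ?thesis using res0 [OF that] c by simp
    qed
    \<comment> \<open>Row \<open>i\<close> of the largest coefficient gives the contradiction: the
      \<open>n\<close> error terms are each below \<open>\<bar>c i\<bar> / n\<close> and cannot
      cancel \<open>c i\<close>.\<close>
    obtain i where i: "i < n" and imax: "\<And>m. m < n \<Longrightarrow> \<bar>c m\<bar> \<le> \<bar>c i\<bar>"
    proof -
      have "Max ((\<lambda>m. \<bar>c m\<bar>) ` {..<n}) \<in> (\<lambda>m. \<bar>c m\<bar>) ` {..<n}"
        using assms by (intro Max_in) auto
      then obtain i where i: "i < n" "Max ((\<lambda>m. \<bar>c m\<bar>) ` {..<n}) = \<bar>c i\<bar>" by auto
      have "\<bar>c m\<bar> \<le> \<bar>c i\<bar>" if "m < n" for m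
        using that by (subst i(2) [symmetric], intro Max_ge) auto
      with i(1) show ?thesis by (rule that)
    qed
    have pos: "\<bar>c i\<bar> > 0" using imax [OF j] cj by simp
    have "c i = (\<Sum>m<n. c m * mat_one n (i, m)) - (\<Sum>m<n. c m * x (i, m))"
      using i ker [OF i] by (simp add: mat_one_apply if_distrib cong: if_cong)
    also have "\<dots> = (\<Sum>m<n. c m * (mat_one n (i, m) - x (i, m)))"
      by (simp add: right_diff_distrib sum_subtractf)
    finally have "\<bar>c i\<bar> \<le> (\<Sum>m<n. \<bar>c m * (mat_one n (i, m) - x (i, m))\<bar>)"
      using sum_abs by metis
    also have "\<dots> < (\<Sum>m<n. \<bar>c i\<bar> * (1 / real n))"
    proof (rule sum_strict_mono)
      fix m assume m: "m \<in> {..<n}"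
      have "\<bar>c m * (mat_one n (i, m) - x (i, m))\<bar> \<le> \<bar>c i\<bar> * \<bar>mat_one n (i, m) - x (i, m)\<bar>"
        using m imax by (simp add: abs_mult mult_right_mono)
      also have "\<dots> < \<bar>c i\<bar> * (1 / real n)"
        using near [OF i, of m] m pos by (intro mult_strict_left_mono) auto
      finally show "\<bar>c m * (mat_one n (i, m) - x (i, m))\<bar> < \<bar>c i\<bar> * (1 / real n)" .
    qed (use assms in auto)
    also have "\<dots> = \<bar>c i\<bar>" using assms by simp
    finally show False by simp
  qed
  then show "x \<in> gs_regular n"
    using x by (simp add: gs_regular_def identity_box_def PiE_iff)
qed

subsection \<open>Haar measure\<close>

definition orth_space :: "nat \<Rightarrow> (nat \<times> nat \<Rightarrow> real) measure" where
  "orth_space n = restrict_space (matrix_space n) (orth_group n)"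

lemma space_orth_space: "space (orth_space n) = orth_group n"
  by (auto simp: orth_space_def space_restrict_space space_matrix_space orth_group_ext)

lemma measurable_orth_spaceI:
  assumes "f \<in> M \<rightarrow>\<^sub>M matrix_space n" "\<And>x. x \<in> space M \<Longrightarrow> f x \<in> orth_group n"
  shows "f \<in> M \<rightarrow>\<^sub>M orth_space n"
  using assms by (auto simp: orth_space_def intro: measurable_restrict_space2)

lemma measurable_orth_spaceD:
  assumes "f \<in> M \<rightarrow>\<^sub>M orth_space n"
  shows "f \<in> M \<rightarrow>\<^sub>M matrix_space n" "\<And>x. x \<in> space M \<Longrightarrow> f x \<in> orth_group n"
  using assms by (auto simp: orth_space_def measurable_restrict_space2_iff)

lemma measurable_orth_mult:
  assumes "f \<in> M \<rightarrow>\<^sub>M orth_space n" "g \<in> M \<rightarrow>\<^sub>M orth_space n"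
  shows "(\<lambda>x. mat_mult n (f x) (g x)) \<in> M \<rightarrow>\<^sub>M orth_space n"
  using measurable_orth_spaceD [OF assms(1)] measurable_orth_spaceD [OF assms(2)]
  by (intro measurable_orth_spaceI measurable_mat_mult orth_group_mult)

lemma measurable_orth_mult_left: "g \<in> orth_group n \<Longrightarrow> mat_mult n g \<in> orth_space n \<rightarrow>\<^sub>M orth_space n"
  by (intro measurable_orth_mult) (auto simp: space_orth_space)

lemma measurable_orth_mult_right:
  "g \<in> orth_group n \<Longrightarrow> (\<lambda>u. mat_mult n u g) \<in> orth_space n \<rightarrow>\<^sub>M orth_space n"
  by (intro measurable_orth_mult) (auto simp: space_orth_space)

lemma measurable_orth_transp: "mat_transp n \<in> orth_space n \<rightarrow>\<^sub>M orth_space n"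
  using measurable_orth_spaceD(1) [OF measurable_ident_sets [OF refl]]
  by (intro measurable_orth_spaceI orth_group_transp measurable_mat_transp) (auto simp: space_orth_space)

definition left_haar :: "nat \<Rightarrow> (nat \<times> nat \<Rightarrow> real) measure \<Rightarrow> bool" where
  "left_haar n M \<longleftrightarrow> sets M = sets (orth_space n) \<and> prob_space M \<and>
     (\<forall>g\<in>orth_group n. distr M M (mat_mult n g) = M)"

definition right_haar :: "nat \<Rightarrow> (nat \<times> nat \<Rightarrow> real) measure \<Rightarrow> bool" where
  "right_haar n M \<longleftrightarrow> sets M = sets (orth_space n) \<and> prob_space M \<and>
     (\<forall>g\<in>orth_group n. distr M M (\<lambda>u. mat_mult n u g) = M)"

text \<open>The set \<open>A\<close> is left-invariant. The ball gives it finite measure, the box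
  inside it gives positive measure, and on it \<open>gs_matrix\<close> is equivariant. Hence the
  preimage of a set under translation by \<open>g\<close> has the measure of the original
  preimage.\<close>

lemma ex_left_haar:
  assumes n: "n > 0"
  shows "\<exists>M. left_haar n M"
proof -
  let ?L = "matrix_lebesgue n"
  define A where "A = matrix_ball n \<inter> gs_regular n"
  define M where "M = distr (uniform_measure ?L A) (orth_space n) (gs_matrix n)"
  have A: "A \<in> sets ?L"
    by (simp add: A_def sets_matrix_lebesgue sets_gs_regular sets_matrix_ball sets.Int)
  have "emeasure ?L (identity_box n) \<le> emeasure ?L A"
    using A identity_box_subset_ball identity_box_subset_regular [OF n]
    by (intro emeasure_mono) (auto simp: A_def)
  then have A0: "emeasure ?L A \<noteq> 0"
    using emeasure_identity_box [OF n] by auto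
  have "emeasure ?L A \<le> emeasure ?L (matrix_ball n)"
    by (intro emeasure_mono) (auto simp: A_def sets_matrix_lebesgue)
  then have Ainf: "emeasure ?L A \<noteq> \<infinity>"
    using emeasure_matrix_ball_finite [of n] by (auto simp: top_unique)
  have "gs_matrix n \<in> matrix_space n \<rightarrow>\<^sub>M orth_space n"
    by (intro measurable_orth_spaceI measurable_gs_matrix gs_matrix_orth)
  then have gs: "gs_matrix n \<in> ?L \<rightarrow>\<^sub>M orth_space n" "gs_matrix n \<in> uniform_measure ?L A \<rightarrow>\<^sub>M orth_space n"
    by (simp_all cong: measurable_cong_sets add: sets_matrix_lebesgue)
  have em: "emeasure M E = emeasure ?L (A \<inter> (gs_matrix n -` E \<inter> space ?L)) / emeasure ?L A"
    if "E \<in> sets (orth_space n)" for E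
    using gs that A measurable_sets [OF gs(1)] unfolding M_def by (simp add: emeasure_distr)
  have sM: "sets M = sets (orth_space n)" by (simp add: M_def)
  have "distr M M (mat_mult n g) = M" if g: "g \<in> orth_group n" for g
  proof (rule measure_eqI)
    fix E assume "E \<in> sets (distr M M (mat_mult n g))"
    then have E: "E \<in> sets (orth_space n)" by (simp add: sM)
    note mg = measurable_orth_mult_left [OF g]
    then have mgM: "mat_mult n g \<in> M \<rightarrow>\<^sub>M M"
      by (simp cong: measurable_cong_sets add: sM)
    let ?S = "A \<inter> (gs_matrix n -` E \<inter> space ?L)"
    let ?T = "A \<inter> (gs_matrix n -` (mat_mult n g -` E \<inter> orth_group n) \<inter> space ?L)"
    have S: "?S \<in> sets ?L"
      using A measurable_sets [OF gs(1) E] by (rule sets.Int)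
    have T: "?T \<in> sets ?L"
      using A measurable_sets [OF gs(1) measurable_sets [OF mg E]] by (auto simp: space_orth_space)
    have ST: "indicator ?S (mat_mult n g x) = (indicator ?T x :: ennreal)" if "x \<in> space ?L" for x
    proof -
      have x: "x \<in> extensional ({..<n} \<times> {..<n})" using that by (simp add: space_matrix_lebesgue)
      have "mat_mult n g x \<in> A \<longleftrightarrow> x \<in> A"
        using matrix_ball_mult_iff [OF g x] gs_regular_mult_iff [OF g x] by (simp add: A_def)
      moreover have "gs_matrix n (mat_mult n g x) = mat_mult n g (gs_matrix n x)" if "x \<in> A"
        using gs_matrix_mult [OF g] that by (simp add: A_def)
      ultimately have "mat_mult n g x \<in> ?S \<longleftrightarrow> x \<in> ?T"
        using x gs_matrix_orth [of n x] by (auto simp: space_matrix_lebesgue)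
      then show ?thesis by (simp only: indicator_def)
    qed
    have "emeasure ?L ?T = (\<integral>\<^sup>+x. indicator ?T x \<partial>?L)"
      using T by simp
    also have "\<dots> = (\<integral>\<^sup>+x. indicator ?S (mat_mult n g x) \<partial>?L)"
      by (intro nn_integral_cong) (simp only: ST)
    also have "\<dots> = (\<integral>\<^sup>+x. indicator ?S x \<partial>?L)"
      using S by (intro nn_integral_matrix_lebesgue_mult n g borel_measurable_indicator)
        (simp add: sets_matrix_lebesgue)
    also have "\<dots> = emeasure ?L ?S"
      using S by simp
    finally have TS: "emeasure ?L ?T = emeasure ?L ?S" .
    have spM: "space M = orth_group n" using sets_eq_imp_space_eq [OF sM] by (simp add: space_orth_space)
    have "emeasure (distr M M (mat_mult n g)) E = emeasure M (mat_mult n g -` E \<inter> orth_group n)"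
      using mgM E by (simp add: emeasure_distr sM spM)
    also have "\<dots> = emeasure ?L ?T / emeasure ?L A"
      using measurable_sets [OF mg E] by (intro em) (simp add: space_orth_space)
    also have "\<dots> = emeasure M E"
      using TS em [OF E] by simp
    finally show "emeasure (distr M M (mat_mult n g)) E = emeasure M E" .
  qed simp
  moreover have "prob_space M"
    unfolding M_def using gs(2) A0 Ainf
    by (intro prob_space.prob_space_distr prob_space_uniform_measure)
  ultimately show ?thesis using sM unfolding left_haar_def by blast
qed

text \<open>The double integral of the indicator of \<open>A\<close> at the product
  \<open>h u\<close> equals \<open>emeasure M A\<close> if \<open>u\<close> is integrated first and
  \<open>emeasure N A\<close> if \<open>h\<close> is integrated first.\<close>

lemma left_haar_eq_right_haar:
  assumes M: "left_haar n M" and N: "right_haar n N"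
  shows "M = N"
proof -
  interpret M: prob_space M using M by (simp add: left_haar_def)
  interpret N: prob_space N using N by (simp add: right_haar_def)
  interpret MN: pair_sigma_finite M N ..
  have sM [measurable_cong]: "sets M = sets (orth_space n)" using M by (simp add: left_haar_def)
  have sN [measurable_cong]: "sets N = sets (orth_space n)" using N by (simp add: right_haar_def)
  have spM: "space M = orth_group n" using sets_eq_imp_space_eq [OF sM] by (simp add: space_orth_space)
  have spN: "space N = orth_group n" using sets_eq_imp_space_eq [OF sN] by (simp add: space_orth_space)
  have mult: "(\<lambda>(u, h). mat_mult n h u) \<in> M \<Otimes>\<^sub>M N \<rightarrow>\<^sub>M orth_space n"
    unfolding split_beta
    by (intro measurable_orth_mult measurable_compose [OF measurable_fst] measurable_compose [OF measurable_snd]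
        measurable_ident_sets sM sN)
  show ?thesis
  proof (rule measure_eqI)
    fix A assume "A \<in> sets M"
    then have A [measurable]: "A \<in> sets (orth_space n)" by (simp add: sM)
    have left: "(\<integral>\<^sup>+u. indicator A (mat_mult n h u) \<partial>M) = emeasure M A" if h: "h \<in> orth_group n" for h
    proof -
      have "emeasure M A = (\<integral>\<^sup>+u. indicator A u \<partial>distr M M (mat_mult n h))"
        using M h A by (simp add: left_haar_def sM)
      also have "\<dots> = (\<integral>\<^sup>+u. indicator A (mat_mult n h u) \<partial>M)"
        using measurable_orth_mult_left [OF h] A
        by (intro nn_integral_distr) (simp_all cong: measurable_cong_sets add: sM)
      finally show ?thesis by simp
    qed
    have right: "(\<integral>\<^sup>+h. indicator A (mat_mult n h u) \<partial>N) = emeasure N A" if u: "u \<in> orth_group n" for u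
    proof -
      have "emeasure N A = (\<integral>\<^sup>+h. indicator A h \<partial>distr N N (\<lambda>h. mat_mult n h u))"
        using N u A by (simp add: right_haar_def sN)
      also have "\<dots> = (\<integral>\<^sup>+h. indicator A (mat_mult n h u) \<partial>N)"
        using measurable_orth_mult_right [OF u] A
        by (intro nn_integral_distr) (simp_all cong: measurable_cong_sets add: sN)
      finally show ?thesis by simp
    qed
    have "emeasure M A = (\<integral>\<^sup>+h. \<integral>\<^sup>+u. indicator A (mat_mult n h u) \<partial>M \<partial>N)"
    proof -
      have "(\<integral>\<^sup>+h. \<integral>\<^sup>+u. indicator A (mat_mult n h u) \<partial>M \<partial>N) = (\<integral>\<^sup>+h. emeasure M A \<partial>N)"
        by (intro nn_integral_cong) (simp add: spN left)
      then show ?thesis by (simp add: N.emeasure_space_1)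
    qed
    also have "\<dots> = (\<integral>\<^sup>+u. \<integral>\<^sup>+h. indicator A (mat_mult n h u) \<partial>N \<partial>M)"
      using measurable_compose [OF mult borel_measurable_indicator [OF A]]
      by (intro MN.Fubini') (simp add: case_prod_unfold)
    also have "\<dots> = emeasure N A"
    proof -
      have "(\<integral>\<^sup>+u. \<integral>\<^sup>+h. indicator A (mat_mult n h u) \<partial>N \<partial>M) = (\<integral>\<^sup>+u. emeasure N A \<partial>M)"
        by (intro nn_integral_cong) (simp add: spM right)
      then show ?thesis by (simp add: M.emeasure_space_1)
    qed
    finally show "emeasure M A = emeasure N A" .
  qed (simp add: sM sN)
qed

text \<open>Transposition turns right multiplication by \<open>g\<close> into left multiplication by
  the transpose of \<open>g\<close>, which is again orthogonal.\<close>

lemma right_haar_transp: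
  assumes M: "left_haar n M"
  shows "right_haar n (distr M M (mat_transp n))"
proof -
  interpret M: prob_space M using M by (simp add: left_haar_def)
  have sM [measurable_cong]: "sets M = sets (orth_space n)" using M by (simp add: left_haar_def)
  have spM: "space M = orth_group n" using sets_eq_imp_space_eq [OF sM] by (simp add: space_orth_space)
  have tM: "mat_transp n \<in> M \<rightarrow>\<^sub>M M"
    using measurable_orth_transp by (simp cong: measurable_cong_sets add: sM)
  let ?N = "distr M M (mat_transp n)"
  have "distr ?N ?N (\<lambda>u. mat_mult n u g) = ?N" if g: "g \<in> orth_group n" for g
  proof -
    have gM: "(\<lambda>u. mat_mult n u g) \<in> M \<rightarrow>\<^sub>M M" "mat_mult n (mat_transp n g) \<in> M \<rightarrow>\<^sub>M M"
      using measurable_orth_mult_right [OF g] measurable_orth_mult_left [OF orth_group_transp [OF g]]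
      by (simp_all cong: measurable_cong_sets add: sM)
    have "distr ?N ?N (\<lambda>u. mat_mult n u g) = distr ?N M (\<lambda>u. mat_mult n u g)"
      by (rule distr_cong) auto
    also have "\<dots> = distr M M ((\<lambda>u. mat_mult n u g) \<circ> mat_transp n)"
      using tM gM by (intro distr_distr)
    also have "\<dots> = distr M M (mat_transp n \<circ> mat_mult n (mat_transp n g))"
      using g by (intro distr_cong) (auto simp: mat_transp_mult mat_transp_transp orth_group_ext)
    also have "\<dots> = distr (distr M M (mat_mult n (mat_transp n g))) M (mat_transp n)"
      using tM gM by (intro distr_distr [symmetric])
    also have "\<dots> = ?N"
      using M g by (simp add: left_haar_def orth_group_transp)
    finally show ?thesis .
  qed
  moreover have "prob_space ?N"
    using tM by (rule M.prob_space_distr)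
  ultimately show ?thesis using sM by (simp add: right_haar_def)
qed

lemma left_haar_haar_orth:
  assumes "n > 0"
  shows "left_haar n (haar_orth n)"
proof -
  obtain M where M: "left_haar n M" using ex_left_haar [OF assms] by blast
  \<comment> \<open>Every left Haar measure equals one and the same right Haar measure, the
    transpose of \<open>M\<close>.\<close>
  have uniq: "N = M" if "left_haar n N" for N
    using left_haar_eq_right_haar [OF that right_haar_transp [OF M]]
      left_haar_eq_right_haar [OF M right_haar_transp [OF M]] by simp
  from M uniq have "left_haar n (THE M. left_haar n M)" by (rule theI)
  then show ?thesis by (simp add: haar_orth_def left_haar_def orth_space_def)
qed

lemma haar_orth_transp:
  assumes "n > 0"
  shows "distr (haar_orth n) (haar_orth n) (mat_transp n) = haar_orth n"
  using left_haar_eq_right_haar [OF left_haar_haar_orth right_haar_transp [OF left_haar_haar_orth]] assms by simp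

subsection \<open>Invariant tensors\<close>

text \<open>A tensor on real \<open>n\<close>-space with one factor for each element of
  \<open>R\<close>, given by its coordinates and fixed by every orthogonal matrix acting on all
  factors simultaneously.\<close>

definition invariant_tensor :: "nat \<Rightarrow> 'r set \<Rightarrow> (('r \<Rightarrow> nat) \<Rightarrow> real) \<Rightarrow> bool" where
  "invariant_tensor n R T \<longleftrightarrow> (\<forall>g\<in>orth_group n. \<forall>i\<in>R \<rightarrow>\<^sub>E {..<n}.
     T i = (\<Sum>l\<in>R \<rightarrow>\<^sub>E {..<n}. (\<Prod>r\<in>R. g (i r, l r)) * T l))"

lemma invariant_tensorD:
  "invariant_tensor n R T \<Longrightarrow> g \<in> orth_group n \<Longrightarrow> i \<in> R \<rightarrow>\<^sub>E {..<n} \<Longrightarrow>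
    T i = (\<Sum>l\<in>R \<rightarrow>\<^sub>E {..<n}. (\<Prod>r\<in>R. g (i r, l r)) * T l)"
  by (simp add: invariant_tensor_def)

text \<open>Signed permutation matrices: the source of both the sign changes and the relabellings of
  coordinates.\<close>

lemma monomial_matrix_orth:
  assumes \<sigma>: "bij_betw \<sigma> {..<n} {..<n}" and s: "\<And>x. x < n \<Longrightarrow> s x * s x = (1::real)"
  shows "(\<lambda>ij\<in>{..<n} \<times> {..<n}. if snd ij = \<sigma> (fst ij) then s (fst ij) else 0) \<in> orth_group n"
    (is "?g \<in> _")
proof -
  have "(\<Sum>l<n. ?g (x, l) * ?g (y, l)) = (if x = y then 1 else 0)" if xy: "x < n" "y < n" for x y
  proof -
    have sx: "\<sigma> x < n" using \<sigma> xy by (auto simp: bij_betw_def)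
    have "(\<Sum>l<n. ?g (x, l) * ?g (y, l)) = (\<Sum>l<n. if l = \<sigma> x then s x * (if l = \<sigma> y then s y else 0) else 0)"
      using xy by (intro sum.cong refl) simp
    also have "\<dots> = s x * (if \<sigma> x = \<sigma> y then s y else 0)"
      using sx by simp
    also have "\<dots> = (if x = y then 1 else 0)"
      using \<sigma> xy s by (auto simp: bij_betw_def inj_on_def)
    finally show ?thesis .
  qed
  then show ?thesis by (auto simp: orth_group_def)
qed

text \<open>Each row of a signed permutation matrix has a single nonzero entry, so a single word
  survives in the invariance relation.\<close>

lemma invariant_tensor_monomial:
  assumes T: "invariant_tensor n R T" and R: "finite R" and i: "i \<in> R \<rightarrow>\<^sub>E {..<n}"
    and \<sigma>: "bij_betw \<sigma> {..<n} {..<n}" and s: "\<And>x. x < n \<Longrightarrow> s x * s x = (1::real)"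
  shows "T i = (\<Prod>r\<in>R. s (i r)) * T (\<lambda>r\<in>R. \<sigma> (i r))"
proof -
  let ?g = "\<lambda>ij\<in>{..<n} \<times> {..<n}. if snd ij = \<sigma> (fst ij) then s (fst ij) else 0"
  let ?l = "\<lambda>r\<in>R. \<sigma> (i r)"
  have l: "?l \<in> R \<rightarrow>\<^sub>E {..<n}" using i \<sigma> by (auto simp: bij_betw_def PiE_iff)
  have ir: "i r < n" if "r \<in> R" for r using i that by auto
  have "(\<Prod>r\<in>R. ?g (i r, l r)) = (if l = ?l then \<Prod>r\<in>R. s (i r) else 0)" if l': "l \<in> R \<rightarrow>\<^sub>E {..<n}" for l
  proof (cases "l = ?l")
    case True
    have "?g (i r, l r) = s (i r)" if "r \<in> R" for r
    proof -
      have "l r < n" using l' that by auto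
      moreover have "l r = \<sigma> (i r)" using True that by simp
      ultimately show ?thesis using ir [OF that] by simp
    qed
    then have "(\<Prod>r\<in>R. ?g (i r, l r)) = (\<Prod>r\<in>R. s (i r))" by (rule prod.cong [OF refl])
    then show ?thesis unfolding if_P [OF True] .
  next
    case False
    have "\<exists>r\<in>R. l r \<noteq> \<sigma> (i r)"
    proof (rule ccontr)
      assume "\<not> (\<exists>r\<in>R. l r \<noteq> \<sigma> (i r))"
      then have "l = ?l" by (intro PiE_ext [OF l' l]) simp
      with False show False ..
    qed
    then obtain r where r: "r \<in> R" "l r \<noteq> \<sigma> (i r)" by blast
    then have "?g (i r, l r) = 0" using PiE_mem [OF l' r(1)] ir by simp
    then have "(\<Prod>r\<in>R. ?g (i r, l r)) = 0" using R r(1) by (intro prod_zero) blast+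
    then show ?thesis unfolding if_not_P [OF False] .
  qed
  note g_prod = this
  have "T i = (\<Sum>l\<in>R \<rightarrow>\<^sub>E {..<n}. (\<Prod>r\<in>R. ?g (i r, l r)) * T l)"
    by (rule invariant_tensorD [OF T monomial_matrix_orth [OF \<sigma> s] i])
  also have "\<dots> = (\<Sum>l\<in>R \<rightarrow>\<^sub>E {..<n}. if l = ?l then (\<Prod>r\<in>R. s (i r)) * T l else 0)"
    by (intro sum.cong refl) (simp only: g_prod split: if_splits, simp)
  finally have "T i = (\<Sum>l\<in>R \<rightarrow>\<^sub>E {..<n}. if l = ?l then (\<Prod>r\<in>R. s (i r)) * T l else 0)" .
  then show ?thesis using l R by (simp add: finite_PiE)
qed

text \<open>Reflecting coordinate \<open>a\<close> multiplies the value by -1 once for each element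
  of the fibre.\<close>

lemma invariant_tensor_odd:
  assumes T: "invariant_tensor n R T" and R: "finite R" and i: "i \<in> R \<rightarrow>\<^sub>E {..<n}"
    and a: "odd (card {r\<in>R. i r = a})"
  shows "T i = 0"
proof -
  have "(\<lambda>r\<in>R. i r) = i" using i by (simp add: PiE_restrict)
  then have "T i = (\<Prod>r\<in>R. if i r = a then -1 else 1) * T i"
    using invariant_tensor_monomial [OF T R i, of id "\<lambda>x. if x = a then -1 else 1"] by auto
  also have "(\<Prod>r\<in>R. if i r = a then -1 else 1) = (-1::real) ^ card {r\<in>R. i r = a}"
    using R by (simp add: prod.If_cases Int_def)
  finally show ?thesis using a by simp
qed

lemma invariant_tensor_kernel:
  assumes T: "invariant_tensor n R T" and R: "finite R"
    and i: "i \<in> R \<rightarrow>\<^sub>E {..<n}" and j: "j \<in> R \<rightarrow>\<^sub>E {..<n}"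
    and ker: "\<And>x y. x \<in> R \<Longrightarrow> y \<in> R \<Longrightarrow> i x = i y \<longleftrightarrow> j x = j y"
  shows "T i = T j"
proof -
  define f where "f v = j (inv_into R i v)" for v
  have fi: "f (i r) = j r" if "r \<in> R" for r
    using that ker [of "inv_into R i (i r)" r]
    by (simp add: f_def inv_into_into f_inv_into_f)
  have f: "bij_betw f (i ` R) (j ` R)"
    unfolding bij_betw_def inj_on_def using ker by (auto simp: fi image_image)
  have sub: "i ` R \<subseteq> {..<n}" "j ` R \<subseteq> {..<n}" using i j by auto
  have "card (i ` R) = card (j ` R)" using f by (rule bij_betw_same_card)
  then have "card ({..<n} - i ` R) = card ({..<n} - j ` R)"
    using sub R by (simp add: card_Diff_subset)
  then obtain h where h: "bij_betw h ({..<n} - i ` R) ({..<n} - j ` R)"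
    using finite_same_card_bij [of "{..<n} - i ` R" "{..<n} - j ` R"] by auto
  define \<sigma> where "\<sigma> v = (if v \<in> i ` R then f v else h v)" for v
  have "bij_betw \<sigma> (i ` R \<union> ({..<n} - i ` R)) (j ` R \<union> ({..<n} - j ` R))"
  proof (rule bij_betw_combine)
    show "bij_betw \<sigma> (i ` R) (j ` R)"
      using f by (rule bij_betw_cong [THEN iffD1, rotated]) (simp add: \<sigma>_def)
    show "bij_betw \<sigma> ({..<n} - i ` R) ({..<n} - j ` R)"
      using h by (rule bij_betw_cong [THEN iffD1, rotated]) (simp add: \<sigma>_def)
  qed auto
  then have "bij_betw \<sigma> {..<n} {..<n}" using sub by (simp add: Un_absorb1)
  then have "T i = T (\<lambda>r\<in>R. \<sigma> (i r))"
    using invariant_tensor_monomial [OF T R i, of \<sigma> "\<lambda>_. 1"] by simp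
  also have "(\<lambda>r\<in>R. \<sigma> (i r)) = j"
    using j by (intro PiE_ext [of _ R "\<lambda>_. {..<n}"]) (auto simp: \<sigma>_def fi)
  finally show ?thesis .
qed

section \<open>Infinitesimal plane rotations\<close>

definition plane_rotation :: "nat \<Rightarrow> nat \<Rightarrow> nat \<Rightarrow> real \<Rightarrow> (nat \<times> nat \<Rightarrow> real)" where
  "plane_rotation n a b t = (\<lambda>(x, y)\<in>{..<n} \<times> {..<n}.
     if x = a then (if y = a then cos t else if y = b then sin t else 0)
     else if x = b then (if y = a then - sin t else if y = b then cos t else 0)
     else if x = y then 1 else 0)"

lemma plane_rotation_apply:
  "x < n \<Longrightarrow> y < n \<Longrightarrow> plane_rotation n a b t (x, y) =
     (if x = a then (if y = a then cos t else if y = b then sin t else 0)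
      else if x = b then (if y = a then - sin t else if y = b then cos t else 0)
      else if x = y then 1 else 0)"
  by (simp add: plane_rotation_def)

lemma plane_rotation_orth:
  assumes ab: "a < n" "b < n" "a \<noteq> b"
  shows "plane_rotation n a b t \<in> orth_group n"
proof -
  \<comment> \<open>The vector \<open>f\<close> is left arbitrary here and becomes another row of
    the rotation below.\<close>
  have row: "(\<Sum>l<n. plane_rotation n a b t (x, l) * f l) =
      (if x = a then cos t * f a + sin t * f b else if x = b then cos t * f b - sin t * f a else f x)"
    if x: "x < n" for x f
  proof -
    have "(\<Sum>l<n. plane_rotation n a b t (x, l) * f l) =
        (\<Sum>l<n. (if l = a then plane_rotation n a b t (x, a) * f a else 0) +
          (if l = b then plane_rotation n a b t (x, b) * f b else 0) +
          (if l = x then (if x = a \<or> x = b then 0 else f x) else 0))"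
      using x ab by (intro sum.cong refl) (auto simp: plane_rotation_apply)
    also have "\<dots> = plane_rotation n a b t (x, a) * f a + plane_rotation n a b t (x, b) * f b
        + (if x = a \<or> x = b then 0 else f x)"
      using x ab by (simp only: sum.distrib sum.delta finite_lessThan lessThan_iff if_True)
    also have "\<dots> = (if x = a then cos t * f a + sin t * f b else if x = b then cos t * f b - sin t * f a else f x)"
      using x ab by (auto simp: plane_rotation_apply)
    finally show ?thesis .
  qed
  have "(\<Sum>l<n. plane_rotation n a b t (x, l) * plane_rotation n a b t (y, l)) = (if x = y then 1 else 0)"
    if "x < n" "y < n" for x y
    unfolding row [OF that(1)] using that ab
    by (auto simp: plane_rotation_apply simp flip: power2_eq_square)
  then show ?thesis by (simp add: orth_group_def plane_rotation_def)
qed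

text \<open>The infinitesimal rotation in the plane of \<open>i r0\<close> and the unused index \<open>b\<close>, applied to
  the word \<open>i(r0 := b)\<close>.\<close>
lemma invariant_tensor_split:
  assumes T: "invariant_tensor n R T" and R: "finite R" and i: "i \<in> R \<rightarrow>\<^sub>E {..<n}"
    and r0: "r0 \<in> R" and b: "b < n" "b \<notin> i ` R"
  shows "T i = (\<Sum>r | r \<in> R \<and> r \<noteq> r0 \<and> i r = i r0. T (i(r0 := b, r := b)))"
proof -
  define a where "a = i r0"
  have a: "a < n" "a \<noteq> b" using i r0 b by (auto simp: a_def)
  define w where "w = i(r0 := b)"
  have w: "w \<in> R \<rightarrow>\<^sub>E {..<n}"
    using i r0 b by (auto simp: w_def PiE_iff extensional_def)
  have wn: "w r < n" if "r \<in> R" for r using w that by auto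
  \<comment> \<open>\<open>D\<close> is the derivative of the rotation at angle 0, with just two
    nonzero entries, and \<open>d\<close> is its value there.\<close>
  define D where "D x y = (if x = a \<and> y = b then 1 else if x = b \<and> y = a then -1 else (0::real))" for x y
  define d where "d x y = (if x = y then 1 else (0::real))" for x y :: nat
  have deriv: "((\<lambda>t. plane_rotation n a b t (x, y)) has_field_derivative D x y) (at 0)" if "x < n" "y < n" for x y
    using that a by (cases "x = a"; cases "x = b"; cases "y = a"; cases "y = b")
      (auto simp: plane_rotation_apply D_def intro!: derivative_eq_intros)
  have at0: "plane_rotation n a b 0 (x, y) = d x y" if "x < n" "y < n" for x y
    using that a by (auto simp: plane_rotation_apply d_def)
  let ?P = "R \<rightarrow>\<^sub>E {..<n}"
  have fP: "finite ?P" using R by (simp add: finite_PiE)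
  have "((\<lambda>t. \<Sum>l\<in>?P. (\<Prod>r\<in>R. plane_rotation n a b t (w r, l r)) * T l) has_field_derivative
      (\<Sum>l\<in>?P. (\<Sum>r\<in>R. D (w r) (l r) * (\<Prod>q\<in>R - {r}. plane_rotation n a b 0 (w q, l q))) * T l)) (at 0)"
    using wn by (intro DERIV_sum DERIV_cmult_right has_field_derivative_prod deriv) auto
  \<comment> \<open>By invariance the sum does not depend on the angle, so the derivative computed
    above is zero.\<close>
  moreover have "(\<lambda>t. \<Sum>l\<in>?P. (\<Prod>r\<in>R. plane_rotation n a b t (w r, l r)) * T l) = (\<lambda>t. T w)"
    using invariant_tensorD [OF T plane_rotation_orth [OF a(1) b(1) a(2)] w] by auto
  ultimately have "((\<lambda>t::real. T w) has_field_derivative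
      (\<Sum>l\<in>?P. (\<Sum>r\<in>R. D (w r) (l r) * (\<Prod>q\<in>R - {r}. plane_rotation n a b 0 (w q, l q))) * T l)) (at 0)"
    by simp
  then have "0 = (\<Sum>l\<in>?P. (\<Sum>r\<in>R. D (w r) (l r) * (\<Prod>q\<in>R - {r}. plane_rotation n a b 0 (w q, l q))) * T l)"
    by (intro DERIV_unique [OF DERIV_const])
  also have "\<dots> = (\<Sum>l\<in>?P. \<Sum>r\<in>R. D (w r) (l r) * (\<Prod>q\<in>R - {r}. d (w q) (l q)) * T l)"
  proof (rule sum.cong [OF refl])
    fix l assume l: "l \<in> ?P"
    have "(\<Prod>q\<in>R - {r}. plane_rotation n a b 0 (w q, l q)) = (\<Prod>q\<in>R - {r}. d (w q) (l q))" for r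
      using wn l by (intro prod.cong refl at0) auto
    then show "(\<Sum>r\<in>R. D (w r) (l r) * (\<Prod>q\<in>R - {r}. plane_rotation n a b 0 (w q, l q))) * T l =
        (\<Sum>r\<in>R. D (w r) (l r) * (\<Prod>q\<in>R - {r}. d (w q) (l q)) * T l)"
      by (simp add: sum_distrib_right)
  qed
  also have "\<dots> = (\<Sum>r\<in>R. \<Sum>l\<in>?P. D (w r) (l r) * (\<Prod>q\<in>R - {r}. d (w q) (l q)) * T l)"
    by (rule sum.swap)
  also have "\<dots> = (\<Sum>r\<in>R. \<Sum>x<n. D (w r) x * T (w(r := x)))"
  proof (rule sum.cong [OF refl])
    fix r assume r: "r \<in> R"
    have inj: "inj_on (\<lambda>x. w(r := x)) {..<n}"
      by (rule inj_onI) (metis fun_upd_same)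
    \<comment> \<open>The Kronecker deltas leave only the words that agree with \<open>w\<close>
      outside \<open>r\<close>; they are parametrised by their letter \<open>x\<close> at
      \<open>r\<close>.\<close>
    have "(\<Sum>l\<in>?P. D (w r) (l r) * (\<Prod>q\<in>R - {r}. d (w q) (l q)) * T l)
        = (\<Sum>l\<in>(\<lambda>x. w(r := x)) ` {..<n}. D (w r) (l r) * (\<Prod>q\<in>R - {r}. d (w q) (l q)) * T l)"
    proof (rule sum.mono_neutral_right [OF fP])
      show "(\<lambda>x. w(r := x)) ` {..<n} \<subseteq> ?P"
        using w r by (auto simp: PiE_iff extensional_def)
      show "\<forall>l\<in>?P - (\<lambda>x. w(r := x)) ` {..<n}. D (w r) (l r) * (\<Prod>q\<in>R - {r}. d (w q) (l q)) * T l = 0"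
      proof
        fix l assume l: "l \<in> ?P - (\<lambda>x. w(r := x)) ` {..<n}"
        then have "l r \<in> {..<n}" using r by auto
        then have "l \<noteq> w(r := l r)" using l by blast
        then obtain q where q: "l q \<noteq> (w(r := l r)) q" by blast
        have "q \<in> R" using q l w r by (cases "q \<in> R") (auto simp: PiE_iff extensional_def split: if_splits)
        moreover have "q \<noteq> r" "w q \<noteq> l q" using q by (auto split: if_splits)
        ultimately have "(\<Prod>q\<in>R - {r}. d (w q) (l q)) = 0"
          using R by (intro prod_zero) (auto simp: d_def)
        then show "D (w r) (l r) * (\<Prod>q\<in>R - {r}. d (w q) (l q)) * T l = 0" by simp
      qed
    qed
    also have "\<dots> = (\<Sum>x<n. D (w r) x * (\<Prod>q\<in>R - {r}. d (w q) ((w(r := x)) q)) * T (w(r := x)))"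
      by (subst sum.reindex [OF inj]) simp
    also have "\<dots> = (\<Sum>x<n. D (w r) x * T (w(r := x)))"
      by (intro sum.cong refl) (simp add: d_def)
    finally show "(\<Sum>l\<in>?P. D (w r) (l r) * (\<Prod>q\<in>R - {r}. d (w q) (l q)) * T l) = (\<Sum>x<n. D (w r) x * T (w(r := x)))" .
  qed
  \<comment> \<open>\<open>D\<close> either turns a letter \<open>a\<close> into \<open>b\<close>,
    or turns \<open>b\<close> into \<open>a\<close> with a minus sign. As \<open>b\<close> occurs in
    \<open>w\<close> at \<open>r0\<close> only, the latter happens once and restores
    \<open>i\<close>.\<close>
  also have "\<dots> = (\<Sum>r\<in>R. (if w r = a then T (w(r := b)) else 0) - (if r = r0 then T i else 0))"
  proof (rule sum.cong [OF refl])
    fix r assume r: "r \<in> R"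
    have wb: "w r = b \<longleftrightarrow> r = r0" using r b by (auto simp: w_def)
    have upd: "w(r0 := a) = i" by (simp add: w_def a_def)
    have "(\<Sum>x<n. D (w r) x * T (w(r := x)))
       = (\<Sum>x<n. (if x = b then (if w r = a then T (w(r := b)) else 0) else 0)
                - (if x = a then (if w r = b then T (w(r := a)) else 0) else 0))"
      using a by (intro sum.cong refl) (auto simp: D_def)
    also have "\<dots> = (if w r = a then T (w(r := b)) else 0) - (if w r = b then T (w(r := a)) else 0)"
      using a b by (simp only: sum_subtractf sum.delta finite_lessThan lessThan_iff if_True)
    also have "\<dots> = (if w r = a then T (w(r := b)) else 0) - (if r = r0 then T i else 0)"
      using wb upd by auto
    finally show "(\<Sum>x<n. D (w r) x * T (w(r := x))) = (if w r = a then T (w(r := b)) else 0) - (if r = r0 then T i else 0)" .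
  qed
  also have "\<dots> = (\<Sum>r\<in>R. if w r = a then T (w(r := b)) else 0) - T i"
    using R r0 by (simp add: sum_subtractf)
  also have "(\<Sum>r\<in>R. if w r = a then T (w(r := b)) else 0) = (\<Sum>r\<in>{r\<in>R. w r = a}. T (w(r := b)))"
    using R by (simp add: sum.inter_filter)
  also have "{r\<in>R. w r = a} = {r. r \<in> R \<and> r \<noteq> r0 \<and> i r = i r0}"
    using a by (auto simp: w_def a_def)
  finally have "T i = (\<Sum>r | r \<in> R \<and> r \<noteq> r0 \<and> i r = i r0. T (w(r := b)))" by linarith
  then show ?thesis unfolding w_def .
qed

subsection \<open>Pairings\<close>

definition compatible :: "'a set set \<Rightarrow> ('a \<Rightarrow> 'b) \<Rightarrow> bool" where
  "compatible p i \<longleftrightarrow> (\<forall>B\<in>p. \<forall>x\<in>B. \<forall>y\<in>B. i x = i y)"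

text \<open>The kernel of \<open>i\<close> on the underlying set is exactly \<open>p\<close>,
  whereas \<open>compatible\<close> only asks \<open>p\<close> to be finer than the kernel.\<close>

definition labels :: "'a set set \<Rightarrow> ('a \<Rightarrow> 'b) \<Rightarrow> bool" where
  "labels p i \<longleftrightarrow> (\<forall>x\<in>\<Union>p. \<forall>y\<in>\<Union>p. i x = i y \<longleftrightarrow> (\<exists>B\<in>p. x \<in> B \<and> y \<in> B))"

lemma compatibleD: "compatible p i \<Longrightarrow> B \<in> p \<Longrightarrow> x \<in> B \<Longrightarrow> y \<in> B \<Longrightarrow> i x = i y"
  unfolding compatible_def by blast

lemma labelsD:
  "labels p i \<Longrightarrow> x \<in> \<Union>p \<Longrightarrow> y \<in> \<Union>p \<Longrightarrow> i x = i y \<longleftrightarrow> (\<exists>B\<in>p. x \<in> B \<and> y \<in> B)"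
  unfolding labels_def by blast

lemma pairings_Union: "t \<in> pairings k \<Longrightarrow> \<Union>t = {1..2*k}"
  by (simp add: pairings_def partition_on_def)

lemma pairings_card: "t \<in> pairings k \<Longrightarrow> B \<in> t \<Longrightarrow> card B = 2"
  by (simp add: pairings_def)

lemma pairings_finite_block: "t \<in> pairings k \<Longrightarrow> B \<in> t \<Longrightarrow> finite B"
  using pairings_card [of t k B] card.infinite by fastforce

lemma pairings_partition: "t \<in> pairings k \<Longrightarrow> partition_on {1..2*k} t"
  by (simp add: pairings_def)

lemma finite_pairings [simp]: "finite (pairings k)"
proof -
  have "pairings k \<subseteq> Pow (Pow {1..2*k})"
    by (auto simp: pairings_def partition_on_def)
  then show ?thesis by (rule finite_subset) simp
qed

lemma partition_on_block_eq:
  "partition_on A t \<Longrightarrow> B \<in> t \<Longrightarrow> C \<in> t \<Longrightarrow> x \<in> B \<Longrightarrow> x \<in> C \<Longrightarrow> B = C"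
  by (auto simp: partition_on_def disjoint_def)

lemma partition_on_block: "partition_on A t \<Longrightarrow> x \<in> A \<Longrightarrow> \<exists>B\<in>t. x \<in> B"
  by (auto simp: partition_on_def)

lemma pairings_partner:
  assumes t: "t \<in> pairings k" and x: "x \<in> {1..2*k}"
  obtains y where "y \<in> {1..2*k}" "y \<noteq> x" "{x, y} \<in> t"
proof -
  obtain B where B: "B \<in> t" "x \<in> B"
    using partition_on_block [OF pairings_partition [OF t] x] by blast
  obtain u v where "B = {u, v}" "u \<noteq> v"
    using pairings_card [OF t B(1)] by (auto simp: card_2_iff)
  with B(2) obtain y where "B = {x, y}" "y \<noteq> x" by auto
  with that B(1) pairings_Union [OF t] show ?thesis by blast
qed

lemma pairings_card_eq:
  assumes "t \<in> pairings k"
  shows "finite t" "card t = k"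
proof -
  show fin: "finite t"
    using finite_elements [OF _ pairings_partition [OF assms]] by simp
  have "2 * k = card (\<Union>t)" using pairings_Union [OF assms] by simp
  also have "\<dots> = (\<Sum>B\<in>t. card B)"
    using partition_onD2 [OF pairings_partition [OF assms]] pairings_finite_block [OF assms]
    by (rule card_Union_disjoint)
  also have "\<dots> = 2 * card t"
    using pairings_card [OF assms] by simp
  finally show "card t = k" by simp
qed

text \<open>The fibre is a disjoint union of blocks, each of size two.\<close>

lemma compatible_imp_even_fibre:
  assumes t: "t \<in> pairings k" and c: "compatible t i"
  shows "even (card {r\<in>{1..2*k}. i r = a})"
proof -
  let ?S = "{B\<in>t. \<forall>x\<in>B. i x = a}"
  have "{r\<in>{1..2*k}. i r = a} = \<Union>?S"
  proof (intro equalityI subsetI)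
    fix r assume r: "r \<in> {r\<in>{1..2*k}. i r = a}"
    then obtain B where "B \<in> t" "r \<in> B" using pairings_Union [OF t] by blast
    moreover from this have "\<forall>x\<in>B. i x = a" using c r unfolding compatible_def by blast
    ultimately show "r \<in> \<Union>?S" by blast
  next
    fix r assume "r \<in> \<Union>?S"
    then show "r \<in> {r\<in>{1..2*k}. i r = a}" unfolding pairings_Union [OF t, symmetric] by blast
  qed
  moreover have "card (\<Union>?S) = (\<Sum>B\<in>?S. card B)"
  proof (rule card_Union_disjoint)
    show "disjoint ?S"
      using partition_onD2 [OF pairings_partition [OF t]] by (rule pairwise_subset) blast
    show "finite B" if "B \<in> ?S" for B using pairings_finite_block [OF t] that by blast
  qed
  moreover have "(\<Sum>B\<in>?S. card B) = 2 * card ?S"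
    using pairings_card [OF t] by simp
  ultimately show ?thesis by simp
qed

text \<open>A block of a compatible pairing lies in a fibre of the same size two and so fills it; no
  choice remains.\<close>

lemma compatible_fibres_pairing:
  assumes i2: "\<And>r. r \<in> {1..2*k} \<Longrightarrow> card {q\<in>{1..2*k}. i q = i r} = 2"
  defines "t0 \<equiv> (\<lambda>r. {q\<in>{1..2*k}. i q = i r}) ` {1..2*k}"
  shows "{t\<in>pairings k. compatible t i} = {t0}" and "labels t0 i"
proof -
  have part: "partition_on {1..2*k} t0"
    by (rule partition_onI) (auto simp: t0_def disjnt_def)
  have t0: "t0 \<in> pairings k"
    using part i2 by (auto simp: pairings_def t0_def)
  have c0: "compatible t0 i" by (auto simp: compatible_def t0_def)
  have "t = t0" if t: "t \<in> pairings k" and c: "compatible t i" for t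
  proof -
    have sub: "B \<in> t0" if B: "B \<in> t" for B
    proof -
      have cB: "card B = 2" using t B by (rule pairings_card)
      then obtain r where r: "r \<in> B" by fastforce
      then have r': "r \<in> {1..2*k}" using B pairings_Union [OF t] by blast
      have "B \<subseteq> {q\<in>{1..2*k}. i q = i r}"
        using c B r unfolding compatible_def pairings_Union [OF t, symmetric] by blast
      then have "B = {q\<in>{1..2*k}. i q = i r}"
        using cB i2 [OF r'] by (intro card_subset_eq) simp_all
      then show ?thesis using r' unfolding t0_def by blast
    qed
    have "C \<in> t" if C: "C \<in> t0" for C
    proof -
      obtain r where r: "r \<in> C" "r \<in> {1..2*k}" using C by (auto simp: t0_def)
      obtain B where B: "B \<in> t" "r \<in> B"
        using partition_on_block [OF pairings_partition [OF t] r(2)] by blast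
      have "B = C" using partition_on_block_eq [OF part sub [OF B(1)] C B(2) r(1)] .
      then show ?thesis using B by simp
    qed
    with sub show ?thesis by blast
  qed
  with t0 c0 show "{t\<in>pairings k. compatible t i} = {t0}" by blast
  show "labels t0 i"
    unfolding labels_def t0_def by (auto simp del: atLeastAtMost_iff)
qed

text \<open>The coefficient of a pairing \<open>t\<close> in an invariant tensor is read off at any word with kernel
  \<open>t\<close>. Splitting off two letters of a fibre with at least four elements
  matches the choice of the partner of \<open>r0\<close> in a compatible pairing.\<close>
lemma invariant_tensor_expansion:
  assumes T: "invariant_tensor n {1..2*k} T" and kn: "k \<le> n"
    and lab: "\<And>t. t \<in> pairings k \<Longrightarrow> lab t \<in> {1..2*k} \<rightarrow>\<^sub>E {..<n}" "\<And>t. t \<in> pairings k \<Longrightarrow> labels t (lab t)"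
    and i: "i \<in> {1..2*k} \<rightarrow>\<^sub>E {..<n}"
  shows "T i = (\<Sum>t\<in>{t\<in>pairings k. compatible t i}. T (lab t))"
  using i
proof (induction "n - card (i ` {1..2*k})" arbitrary: i rule: less_induct)
  case (less i)
  let ?R = "{1..2*k}"
  let ?F = "\<lambda>a. {q\<in>?R. i q = a}"
  note i = \<open>i \<in> ?R \<rightarrow>\<^sub>E {..<n}\<close>
  consider (odd) a where "odd (card (?F a))"
    | (two) "\<And>r. r \<in> ?R \<Longrightarrow> card (?F (i r)) = 2"
    | (big) r0 where "r0 \<in> ?R" "card (?F (i r0)) \<noteq> 2" "\<And>a. even (card (?F a))"
    by blast
  then show ?case
  proof cases
    case odd
    then have no: "{t\<in>pairings k. compatible t i} = {}"
      using compatible_imp_even_fibre [of _ k i a] by blast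
    have "T i = 0" using invariant_tensor_odd [OF T _ i odd] by simp
    then show ?thesis unfolding no by simp
  next
    case two
    define t0 where "t0 = (\<lambda>r. ?F (i r)) ` ?R"
    have t0: "{t\<in>pairings k. compatible t i} = {t0}"
      unfolding t0_def using two by (rule compatible_fibres_pairing(1))
    have lt0: "labels t0 i"
      unfolding t0_def using two by (rule compatible_fibres_pairing(2))
    have "t0 \<in> {t\<in>pairings k. compatible t i}" unfolding t0 by (rule singletonI)
    then have t0p: "t0 \<in> pairings k" by simp
    have "T i = T (lab t0)"
    proof (rule invariant_tensor_kernel [OF T _ i lab(1) [OF t0p]])
      fix x y assume "x \<in> ?R" "y \<in> ?R"
      then have xy: "x \<in> \<Union>t0" "y \<in> \<Union>t0" by (simp_all only: pairings_Union [OF t0p])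
      show "i x = i y \<longleftrightarrow> lab t0 x = lab t0 y"
        by (simp only: labelsD [OF lt0 xy] labelsD [OF lab(2) [OF t0p] xy])
    qed simp
    then show ?thesis unfolding t0 by simp
  next
    case big
    let ?a = "i r0"
    have Fpos: "card (?F (i r)) > 0" if "r \<in> ?R" for r
      using that by (auto simp: card_gt_0_iff)
    have F2: "2 \<le> card (?F a)" if a: "a \<in> i ` ?R" for a
    proof -
      obtain r where "r \<in> ?R" "a = i r" using a by blast
      then have "card (?F a) > 0" using Fpos by simp
      moreover have "card (?F a) \<noteq> 1" using big(3) [of a] by (metis odd_one)
      ultimately show ?thesis by linarith
    qed
    have a: "?a \<in> i ` ?R" using big(1) by blast
    have F3: "3 \<le> card (?F ?a)" using F2 [OF a] big(2) by linarith
    have "2 * card (i ` ?R) = (\<Sum>a\<in>i ` ?R. 2)" by simp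
    also have "\<dots> < (\<Sum>a\<in>i ` ?R. card (?F a))"
    proof (rule sum_strict_mono_ex1)
      show "\<exists>a\<in>i ` ?R. 2 < card (?F a)"
        using F3 by (intro bexI [OF _ a]) linarith
    qed (use F2 in auto)
    also have "\<dots> = card ?R"
      using card_eq_sum [of ?R] sum.image_gen [of ?R "\<lambda>_. 1::nat" i] by simp
    finally have "card (i ` ?R) < n" using kn by simp
    moreover have sub: "i ` ?R \<subseteq> {..<n}" using i by auto
    ultimately have "i ` ?R \<noteq> {..<n}" by auto
    then obtain b where b: "b < n" "b \<notin> i ` ?R" using sub by blast
    define C where "C = {r. r \<in> ?R \<and> r \<noteq> r0 \<and> i r = ?a}"
    define w where "w r = i(r0 := b, r := b)" for r
    define S where "S r = {t\<in>pairings k. compatible t (w r)}" for r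
    have finC: "finite C" by (rule finite_subset [of _ ?R]) (auto simp: C_def)
    have wR: "w r \<in> ?R \<rightarrow>\<^sub>E {..<n}" if "r \<in> C" for r
      using i b that big(1) by (auto simp: w_def C_def PiE_iff extensional_def)
    have IH: "T (w r) = (\<Sum>t\<in>S r. T (lab t))" if r: "r \<in> C" for r
    proof -
      \<comment> \<open>A third position \<open>q\<close> in the fibre keeps the old letter alive
        after \<open>r0\<close> and \<open>r\<close> have been relabelled; without it the number of
        letters would not grow.\<close>
      have "\<exists>q. q \<in> ?F ?a - {r0, r}"
      proof (rule ccontr)
        assume "\<nexists>q. q \<in> ?F ?a - {r0, r}"
        then have "?F ?a \<subseteq> {r0, r}" by blast
        then have "card (?F ?a) \<le> card {r0, r}" by (intro card_mono) auto
        also have "\<dots> \<le> 2" by (simp add: card_insert_if)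
        finally show False using F3 by simp
      qed
      then obtain q where q: "q \<in> ?R" "i q = ?a" "q \<noteq> r0" "q \<noteq> r" by blast
      have "insert b (i ` ?R) \<subseteq> w r ` ?R"
      proof
        fix v assume "v \<in> insert b (i ` ?R)"
        then consider "v = b" | "v = ?a" | x where "x \<in> ?R" "v = i x" "i x \<noteq> ?a" by blast
        then show "v \<in> w r ` ?R"
        proof cases
          case 1
          then have "v = w r r0" by (simp add: w_def)
          then show ?thesis using big(1) by blast
        next
          case 2
          then have "v = w r q" using q by (simp add: w_def)
          then show ?thesis using q(1) by blast
        next
          case 3
          then have "x \<noteq> r0" "x \<noteq> r" using r by (auto simp: C_def)
          then have "v = w r x" using 3 by (simp add: w_def)
          then show ?thesis using 3(1) by blast
        qed
      qed
      then have "card (insert b (i ` ?R)) \<le> card (w r ` ?R)"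
        by (rule card_mono [rotated]) simp
      then have "card (i ` ?R) < card (w r ` ?R)" using b(2) by simp
      then have "n - card (w r ` ?R) < n - card (i ` ?R)"
        using \<open>card (i ` ?R) < n\<close> by linarith
      then show ?thesis unfolding S_def using wR [OF r] by (rule less.hyps)
    qed
    \<comment> \<open>The new letter \<open>b\<close> occurs in \<open>w r\<close> at
      \<open>r0\<close> and \<open>r\<close> only, which forces a compatible pairing to join these
      two; elsewhere \<open>w r\<close> and \<open>i\<close> agree.\<close>
    have S: "S r = {t\<in>pairings k. compatible t i \<and> {r0, r} \<in> t}" if r: "r \<in> C" for r
    proof (rule Collect_cong [of "\<lambda>t. t \<in> pairings k \<and> compatible t (w r)", folded S_def], rule conj_cong [OF refl])
      fix t assume t: "t \<in> pairings k"
      have rr: "r \<in> ?R" "r \<noteq> r0" "i r = ?a" using r by (auto simp: C_def)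
      have only: "B = {r0, r}" if "B \<in> t" "{r0, r} \<in> t" "x \<in> B" "x = r0 \<or> x = r" for B x
        using partition_on_block_eq [OF pairings_partition [OF t] that(1,2,3)] that(4) by blast
      have off: "w r x = i x" if "x \<noteq> r0" "x \<noteq> r" for x using that by (simp add: w_def)
      have on: "w r r0 = b" "w r r = b" by (simp_all add: w_def)
      show "compatible t (w r) \<longleftrightarrow> compatible t i \<and> {r0, r} \<in> t"
      proof
        assume c: "compatible t (w r)"
        obtain y where y: "y \<in> ?R" "y \<noteq> r0" "{r0, y} \<in> t" using pairings_partner [OF t big(1)] .
        have "w r y = b" using c y(3) on(1) unfolding compatible_def by (metis insertI1 insert_commute)
        then have "y = r" using off [of y] y b by fastforce
        with y have rt: "{r0, r} \<in> t" by simp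
        have "i x = i y" if B: "B \<in> t" "x \<in> B" "y \<in> B" for B x y
        proof (cases "B = {r0, r}")
          case True
          then show ?thesis using B rr by auto
        next
          case False
          then have "x \<noteq> r0" "x \<noteq> r" "y \<noteq> r0" "y \<noteq> r" using only [OF B(1) rt] B by blast+
          moreover have "w r x = w r y" using c B unfolding compatible_def by blast
          ultimately show ?thesis using off by simp
        qed
        then show "compatible t i \<and> {r0, r} \<in> t" using rt unfolding compatible_def by blast
      next
        assume c: "compatible t i \<and> {r0, r} \<in> t"
        have "w r x = w r y" if B: "B \<in> t" "x \<in> B" "y \<in> B" for B x y
        proof (cases "B = {r0, r}")
          case True
          then show ?thesis using B on by auto
        next
          case False
          then have "x \<noteq> r0" "x \<noteq> r" "y \<noteq> r0" "y \<noteq> r" using only [OF B(1)] c B by blast+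
          moreover have "i x = i y" using c B unfolding compatible_def by blast
          ultimately show ?thesis using off by simp
        qed
        then show "compatible t (w r)" unfolding compatible_def by blast
      qed
    qed
    have "T i = (\<Sum>r\<in>C. T (w r))"
      unfolding C_def w_def by (rule invariant_tensor_split [OF T _ i big(1) b]) simp
    also have "\<dots> = (\<Sum>r\<in>C. \<Sum>t\<in>S r. T (lab t))"
      using IH by (rule sum.cong [OF refl])
    also have "\<dots> = (\<Sum>t\<in>(\<Union>r\<in>C. S r). T (lab t))"
    proof (rule sum.UNION_disjoint [symmetric, OF finC])
      show "\<forall>r\<in>C. finite (S r)" by (simp add: S_def)
      show "\<forall>r\<in>C. \<forall>q\<in>C. r \<noteq> q \<longrightarrow> S r \<inter> S q = {}"
      proof (intro ballI impI)
        fix r q assume rq: "r \<in> C" "q \<in> C" "r \<noteq> q"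
        have False if "t \<in> S r" "t \<in> S q" for t
        proof -
          have t: "t \<in> pairings k" "{r0, r} \<in> t" "{r0, q} \<in> t"
            using that unfolding S [OF rq(1)] S [OF rq(2)] by blast+
          then have "{r0, r} = {r0, q}"
            using partition_on_block_eq [OF pairings_partition [OF t(1)] t(2,3), of r0] by simp
          then show False using rq by (auto simp: doubleton_eq_iff)
        qed
        then show "S r \<inter> S q = {}" by blast
      qed
    qed
    also have "(\<Union>r\<in>C. S r) = {t\<in>pairings k. compatible t i}"
    proof (intro equalityI subsetI)
      fix t assume "t \<in> (\<Union>r\<in>C. S r)"
      then obtain r where "r \<in> C" "t \<in> S r" by blast
      then show "t \<in> {t\<in>pairings k. compatible t i}" using S [of r] by simp
    next
      fix t assume t: "t \<in> {t\<in>pairings k. compatible t i}"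
      then have tp: "t \<in> pairings k" by blast
      obtain y where y: "y \<in> ?R" "y \<noteq> r0" "{r0, y} \<in> t" using pairings_partner [OF tp big(1)] .
      have "compatible t i" using t by simp
      then have "i y = ?a" using y(3) by (rule compatibleD) simp_all
      then have "y \<in> C" using y by (simp add: C_def)
      moreover have "t \<in> S y" using S [OF \<open>y \<in> C\<close>] t y(3) by simp
      ultimately show "t \<in> (\<Union>r\<in>C. S r)" by blast
    qed
    finally show ?thesis .
  qed
qed

subsection \<open>Joins of partitions and the Gram matrix\<close>

text \<open>A compatible word is the same as a free choice of one letter per block, so this is the
  distributive law. With \<open>f\<close> constantly 1 it evaluates the Gram matrix, with
  \<open>f\<close> made of entries of \<open>u\<close> it produces inner products of
  columns.\<close>

lemma sum_compatible_eq_prod_blocks: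
  fixes f :: "'b \<Rightarrow> 'a \<Rightarrow> real"
  assumes p: "partition_on R p" and R: "finite R" and X: "finite X"
  shows "(\<Sum>i\<in>{i \<in> R \<rightarrow>\<^sub>E X. compatible p i}. \<Prod>r\<in>R. f (i r) r) = (\<Prod>B\<in>p. \<Sum>x\<in>X. \<Prod>r\<in>B. f x r)"
proof -
  have Un: "\<Union>p = R" using p by (simp add: partition_on_def)
  have finp: "finite p" using R p by (rule finite_elements)
  have finB: "finite B" if "B \<in> p" for B
    using that Un R by (intro finite_subset [of B R]) blast+
  define rep where "rep B = (SOME x. x \<in> B)" for B :: "'a set"
  define blk where "blk r = (THE B. B \<in> p \<and> r \<in> B)" for r
  have rep: "rep B \<in> B" if "B \<in> p" for B
  proof -
    have "B \<noteq> {}" using p that by (auto simp: partition_on_def)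
    then show ?thesis unfolding rep_def by (simp add: some_in_eq)
  qed
  have blk_eq: "blk r = B" if "B \<in> p" "r \<in> B" for r B
    unfolding blk_def
    by (rule the_equality) (use that partition_on_block_eq [OF p] in blast)+
  have blk: "blk r \<in> p" "r \<in> blk r" if r: "r \<in> R" for r
  proof -
    obtain B where B: "B \<in> p" "r \<in> B" using partition_on_block [OF p r] by blast
    show "blk r \<in> p" "r \<in> blk r" using B blk_eq [OF B] by simp_all
  qed
  have repR: "rep B \<in> R" if "B \<in> p" for B using rep [OF that] that Un by blast
  have "(\<Prod>B\<in>p. \<Sum>x\<in>X. \<Prod>r\<in>B. f x r) = (\<Sum>c\<in>p \<rightarrow>\<^sub>E X. \<Prod>B\<in>p. \<Prod>r\<in>B. f (c B) r)"
    using finp X by (rule prod_sum_PiE)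
  also have "\<dots> = (\<Sum>i\<in>{i \<in> R \<rightarrow>\<^sub>E X. compatible p i}. \<Prod>r\<in>R. f (i r) r)"
  proof (rule sum.reindex_bij_witness [where i = "\<lambda>i. \<lambda>B\<in>p. i (rep B)" and j = "\<lambda>c. \<lambda>r\<in>R. c (blk r)"])
    fix c assume c: "c \<in> p \<rightarrow>\<^sub>E X"
    show "(\<lambda>B\<in>p. (\<lambda>r\<in>R. c (blk r)) (rep B)) = c"
    proof (rule PiE_ext [of _ p "\<lambda>_. X"])
      show "(\<lambda>B\<in>p. (\<lambda>r\<in>R. c (blk r)) (rep B)) \<in> p \<rightarrow>\<^sub>E X"
        using c blk repR by (simp add: PiE_iff)
      show "c \<in> p \<rightarrow>\<^sub>E X" by (rule c)
      show "(\<lambda>B\<in>p. (\<lambda>r\<in>R. c (blk r)) (rep B)) B = c B" if "B \<in> p" for B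
        using that repR [OF that] blk_eq [OF that rep [OF that]] by simp
    qed
    have "compatible p (\<lambda>r\<in>R. c (blk r))"
      unfolding compatible_def
    proof (intro ballI)
      fix B x y assume B: "B \<in> p" "x \<in> B" "y \<in> B"
      then have "x \<in> R" "y \<in> R" using Un by blast+
      then show "(\<lambda>r\<in>R. c (blk r)) x = (\<lambda>r\<in>R. c (blk r)) y"
        using blk_eq [OF B(1,2)] blk_eq [OF B(1,3)] by simp
    qed
    moreover have "(\<lambda>r\<in>R. c (blk r)) \<in> R \<rightarrow>\<^sub>E X"
      using c blk by (simp add: PiE_iff)
    ultimately show "(\<lambda>r\<in>R. c (blk r)) \<in> {i \<in> R \<rightarrow>\<^sub>E X. compatible p i}" by simp
    have "(\<Prod>r\<in>R. f ((\<lambda>r\<in>R. c (blk r)) r) r) = (\<Prod>r\<in>\<Union>p. f (c (blk r)) r)"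
      unfolding Un by (rule prod.cong) simp_all
    also have "\<dots> = (\<Prod>B\<in>p. \<Prod>r\<in>B. f (c (blk r)) r)"
    proof -
      have "\<forall>A\<in>p. \<forall>B\<in>p. A \<noteq> B \<longrightarrow> A \<inter> B = {}"
        using partition_onD2 [OF p] by (simp add: disjoint_def)
      then show ?thesis
        using finB by (subst prod.Union_disjoint) (simp_all add: comp_def)
    qed
    also have "\<dots> = (\<Prod>B\<in>p. \<Prod>r\<in>B. f (c B) r)"
      by (intro prod.cong refl) (simp add: blk_eq)
    finally show "(\<Prod>r\<in>R. f ((\<lambda>r\<in>R. c (blk r)) r) r) = (\<Prod>B\<in>p. \<Prod>r\<in>B. f (c B) r)" .
  next
    fix i assume "i \<in> {i \<in> R \<rightarrow>\<^sub>E X. compatible p i}"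
    then have i: "i \<in> R \<rightarrow>\<^sub>E X" "compatible p i" by simp_all
    show "(\<lambda>B\<in>p. i (rep B)) \<in> p \<rightarrow>\<^sub>E X"
      using i(1) repR by (simp add: PiE_iff)
    show "(\<lambda>r\<in>R. (\<lambda>B\<in>p. i (rep B)) (blk r)) = i"
    proof (rule PiE_ext [of _ R "\<lambda>_. X"])
      show "(\<lambda>r\<in>R. (\<lambda>B\<in>p. i (rep B)) (blk r)) \<in> R \<rightarrow>\<^sub>E X"
        using i(1) repR blk by (simp add: PiE_iff)
      show "i \<in> R \<rightarrow>\<^sub>E X" by (rule i(1))
      show "(\<lambda>r\<in>R. (\<lambda>B\<in>p. i (rep B)) (blk r)) r = i r" if r: "r \<in> R" for r
        using compatibleD [OF i(2) blk(1) [OF r] rep [OF blk(1) [OF r]] blk(2) [OF r]] blk(1) [OF r] r by simp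
    qed
  qed
  finally show ?thesis by simp
qed

section \<open>Least upper bounds in the lattice of partitions\<close>

lemma partition_on_block_subset: "partition_on A t \<Longrightarrow> B \<in> t \<Longrightarrow> B \<subseteq> A"
  by (auto simp: partition_on_def)

lemma refines_antisym:
  assumes r: "partition_on A r" and s: "partition_on A s" and rs: "refines r s" "refines s r"
  shows "r = s"
proof -
  have "r \<subseteq> s" if r: "partition_on A r" and s: "partition_on A s" and rs: "refines r s" "refines s r" for r s
  proof
    fix B assume B: "B \<in> r"
    then obtain C where C: "C \<in> s" "B \<subseteq> C" using rs(1) unfolding refines_def by blast
    then obtain D where D: "D \<in> r" "C \<subseteq> D" using rs(2) unfolding refines_def by blast
    have "B \<noteq> {}" using partition_onD3 [OF r] B by blast
    then obtain x where "x \<in> B" by blast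
    then have "B = D" using partition_on_block_eq [OF r B D(1), of x] C D by blast
    then have "B = C" using C D by blast
    then show "B \<in> s" using C by simp
  qed
  from this [OF r s rs] this [OF s r rs(2,1)] show ?thesis by (rule equalityI)
qed

definition same_block :: "'a set set \<Rightarrow> 'a \<Rightarrow> 'a \<Rightarrow> bool" where
  "same_block t x y \<longleftrightarrow> (\<exists>B\<in>t. x \<in> B \<and> y \<in> B)"

text \<open>The least common coarsening is obtained by intersecting the equivalence relations of all
  common coarsenings: the class of \<open>x\<close> consists of the points that none of them
  separates from \<open>x\<close>. Antisymmetry of refinement makes the definite description well
  defined.\<close>

lemma partition_join:
  assumes p: "partition_on A p" and q: "partition_on A q"
  shows "partition_on A (partition_join A p q)" "refines p (partition_join A p q)" "refines q (partition_join A p q)"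
    "\<And>t. partition_on A t \<Longrightarrow> refines p t \<Longrightarrow> refines q t \<Longrightarrow> refines (partition_join A p q) t"
proof -
  define U where "U = {t. partition_on A t \<and> refines p t \<and> refines q t}"
  define cl where "cl x = {y\<in>A. \<forall>t\<in>U. same_block t x y}" for x
  define J where "J = cl ` A"
  have U: "partition_on A t" if "t \<in> U" for t using that by (simp add: U_def)
  have refl: "x \<in> cl x" if "x \<in> A" for x
    using that partition_on_block [OF U] unfolding cl_def same_block_def by blast
  have sym: "y \<in> cl x \<Longrightarrow> x \<in> A \<Longrightarrow> x \<in> cl y" for x y
    unfolding cl_def same_block_def by blast
  have trans: "z \<in> cl x" if "y \<in> cl x" "z \<in> cl y" for x y z
  proof -
    have "same_block t x z" if t: "t \<in> U" for t
    proof -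
      obtain B C where "B \<in> t" "x \<in> B" "y \<in> B" "C \<in> t" "y \<in> C" "z \<in> C"
        using \<open>y \<in> cl x\<close> \<open>z \<in> cl y\<close> t unfolding cl_def same_block_def by blast
      then show ?thesis
        using partition_on_block_eq [OF U [OF t], of B C y] unfolding same_block_def by blast
    qed
    then show ?thesis using \<open>z \<in> cl y\<close> unfolding cl_def by blast
  qed
  have part: "partition_on A J"
  proof (rule partition_onI)
    show "\<Union>J = A" using refl unfolding J_def cl_def by blast
    show "disjnt B C" if BC: "B \<in> J" "C \<in> J" "B \<noteq> C" for B C
    proof (rule ccontr)
      assume "\<not> disjnt B C"
      then obtain z where z: "z \<in> B" "z \<in> C" unfolding disjnt_def by blast
      obtain x y where xy: "x \<in> A" "B = cl x" "y \<in> A" "C = cl y" using BC unfolding J_def by blast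
      have "cl x \<subseteq> cl y" "cl y \<subseteq> cl x"
        using trans sym z xy by blast+
      then show False using xy BC by blast
    qed
    show "{} \<notin> J" using refl unfolding J_def by blast
  qed
  have below: "refines s J" if s: "partition_on A s" and sU: "\<And>t. t \<in> U \<Longrightarrow> refines s t" for s
    unfolding refines_def
  proof
    fix B assume B: "B \<in> s"
    then have "B \<noteq> {}" using partition_onD3 [OF s] by blast
    then obtain x where x: "x \<in> B" by blast
    have BA: "B \<subseteq> A" using s B by (rule partition_on_block_subset)
    have "B \<subseteq> cl x"
    proof
      fix y assume y: "y \<in> B"
      have "same_block t x y" if t: "t \<in> U" for t
      proof -
        obtain C where "C \<in> t" "B \<subseteq> C" using bspec [OF sU [OF t, unfolded refines_def] B] ..
        then show ?thesis using x y unfolding same_block_def by blast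
      qed
      moreover have "y \<in> A" using y BA by (rule rev_subsetD)
      ultimately show "y \<in> cl x" by (simp add: cl_def)
    qed
    moreover have "cl x \<in> J" using x BA by (simp add: J_def subsetD)
    ultimately show "\<exists>C\<in>J. B \<subseteq> C" ..
  qed
  have pJ: "refines p J" by (rule below [OF p]) (simp add: U_def)
  have qJ: "refines q J" by (rule below [OF q]) (simp add: U_def)
  have least: "refines J t" if t: "partition_on A t" "refines p t" "refines q t" for t
    unfolding refines_def
  proof
    have tU: "t \<in> U" using t by (simp add: U_def)
    fix B assume "B \<in> J"
    then obtain x where x: "x \<in> A" "B = cl x" unfolding J_def by blast
    obtain C where C: "C \<in> t" "x \<in> C" using partition_on_block [OF t(1) x(1)] by blast
    have "B \<subseteq> C"
    proof
      fix y assume "y \<in> B"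
      then obtain D where D: "D \<in> t" "x \<in> D" "y \<in> D"
        using x tU unfolding cl_def same_block_def by blast
      then show "y \<in> C" using partition_on_block_eq [OF t(1) D(1) C(1) D(2) C(2)] by simp
    qed
    then show "\<exists>C\<in>t. B \<subseteq> C" using C by blast
  qed
  have "partition_join A p q = J"
    unfolding partition_join_def
  proof (rule the_equality)
    show "partition_on A J \<and> refines p J \<and> refines q J \<and>
        (\<forall>t. partition_on A t \<and> refines p t \<and> refines q t \<longrightarrow> refines J t)"
      using part pJ qJ least by blast
    fix r assume r: "partition_on A r \<and> refines p r \<and> refines q r \<and>
        (\<forall>t. partition_on A t \<and> refines p t \<and> refines q t \<longrightarrow> refines r t)"
    show "r = J"
      using r part pJ qJ least by (intro refines_antisym [of A]) blast+
  qed
  with part pJ qJ least show "partition_on A (partition_join A p q)" "refines p (partition_join A p q)"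
    "refines q (partition_join A p q)"
    "\<And>t. partition_on A t \<Longrightarrow> refines p t \<Longrightarrow> refines q t \<Longrightarrow> refines (partition_join A p q) t"
    by simp_all
qed

lemma compatible_mono:
  assumes "refines p q" "compatible q i"
  shows "compatible p i"
  unfolding compatible_def
proof (intro ballI)
  fix B x y assume B: "B \<in> p" "x \<in> B" "y \<in> B"
  obtain C where C: "C \<in> q" "B \<subseteq> C" using assms(1) B(1) unfolding refines_def by blast
  show "i x = i y" using assms(2) C(1) by (rule compatibleD) (use C B in blast)+
qed

text \<open>If \<open>i\<close> is compatible with both partitions, its kernel \<open>K\<close> is a
  common coarsening of them, and the join refines it.\<close>

lemma compatible_join_iff:
  assumes p: "partition_on A p" and q: "partition_on A q"
  shows "compatible (partition_join A p q) i \<longleftrightarrow> compatible p i \<and> compatible q i"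
proof
  assume "compatible (partition_join A p q) i"
  then show "compatible p i \<and> compatible q i"
    using partition_join(2,3) [OF p q] compatible_mono by blast
next
  assume c: "compatible p i \<and> compatible q i"
  define K where "K = (\<lambda>x. {y\<in>A. i y = i x}) ` A"
  have K: "partition_on A K"
    by (rule partition_onI) (auto simp: K_def disjnt_def)
  have ref: "refines s K" if s: "partition_on A s" and c: "compatible s i" for s
    unfolding refines_def
  proof
    fix B assume B: "B \<in> s"
    then have "B \<noteq> {}" using partition_onD3 [OF s] by blast
    then obtain x where x: "x \<in> B" by blast
    have BA: "B \<subseteq> A" using s B by (rule partition_on_block_subset)
    have "B \<subseteq> {y\<in>A. i y = i x}" using compatibleD [OF c B _ x] BA by blast
    then show "\<exists>C\<in>K. B \<subseteq> C" using x BA unfolding K_def by blast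
  qed
  have "refines (partition_join A p q) K"
    using partition_join(4) [OF p q K] ref [OF p] ref [OF q] c by blast
  moreover have "compatible K i" unfolding compatible_def K_def by auto
  ultimately show "compatible (partition_join A p q) i" by (rule compatible_mono)
qed

text \<open>A word compatible with both pairings is one that is constant on the blocks of the join,
  and each of these blocks contributes a factor \<open>n\<close>.\<close>

lemma gram_eq_sum:
  assumes p: "p \<in> pairings k" and q: "q \<in> pairings k"
  shows "gram k n p q = (\<Sum>i\<in>{1..2*k} \<rightarrow>\<^sub>E {..<n}. of_bool (compatible p i) * of_bool (compatible q i))"
proof -
  note pq = pairings_partition [OF p] pairings_partition [OF q]
  let ?J = "partition_join {1..2*k} p q"
  have "gram k n p q = (\<Prod>B\<in>?J. \<Sum>x\<in>{..<n}. \<Prod>r\<in>B. 1)"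
    by (simp add: gram_def)
  also have "\<dots> = (\<Sum>i\<in>{i \<in> {1..2*k} \<rightarrow>\<^sub>E {..<n}. compatible ?J i}. \<Prod>r\<in>{1..2*k}. 1)"
    by (rule sum_compatible_eq_prod_blocks [symmetric, OF partition_join(1) [OF pq]]) simp_all
  also have "\<dots> = (\<Sum>i\<in>{1..2*k} \<rightarrow>\<^sub>E {..<n}. if compatible ?J i then 1 else 0)"
    by (subst sum.inter_filter) (simp_all add: finite_PiE cong: if_cong)
  also have "\<dots> = (\<Sum>i\<in>{1..2*k} \<rightarrow>\<^sub>E {..<n}. of_bool (compatible p i) * of_bool (compatible q i))"
    by (intro sum.cong refl) (subst compatible_join_iff [OF pq], simp)
  finally show ?thesis .
qed

lemma gram_commute: "p \<in> pairings k \<Longrightarrow> q \<in> pairings k \<Longrightarrow> gram k n p q = gram k n q p"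
  by (simp add: gram_eq_sum mult.commute)

subsection \<open>Moments of Haar measure\<close>

definition haar_moment :: "nat \<Rightarrow> nat set \<Rightarrow> (nat \<Rightarrow> nat) \<Rightarrow> (nat \<Rightarrow> nat) \<Rightarrow> real" where
  "haar_moment n R i j = (LINT u|haar_orth n. (\<Prod>r\<in>R. u (i r, j r)))"

lemma sets_haar_orth: "n > 0 \<Longrightarrow> sets (haar_orth n) = sets (orth_space n)"
  using left_haar_haar_orth by (simp add: left_haar_def)

lemma space_haar_orth: "n > 0 \<Longrightarrow> space (haar_orth n) = orth_group n"
  using sets_eq_imp_space_eq [OF sets_haar_orth] by (simp add: space_orth_space)

lemma prob_space_haar_orth: "n > 0 \<Longrightarrow> prob_space (haar_orth n)"
  using left_haar_haar_orth by (simp add: left_haar_def)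

lemma borel_measurable_haar_monomial:
  assumes n: "n > 0" and "finite R" "i \<in> R \<rightarrow>\<^sub>E {..<n}" "j \<in> R \<rightarrow>\<^sub>E {..<n}"
  shows "(\<lambda>u. \<Prod>r\<in>R. u (i r, j r)) \<in> borel_measurable (haar_orth n)"
proof (rule borel_measurable_prod)
  fix r assume r: "r \<in> R"
  have "(\<lambda>u. u) \<in> haar_orth n \<rightarrow>\<^sub>M orth_space n"
    by (rule measurable_ident_sets [OF sets_haar_orth [OF n]])
  then have "(\<lambda>u. u) \<in> haar_orth n \<rightarrow>\<^sub>M matrix_space n" by (rule measurable_orth_spaceD)
  then show "(\<lambda>u. u (i r, j r)) \<in> borel_measurable (haar_orth n)"
    using PiE_mem [OF assms(3) r] PiE_mem [OF assms(4) r] by (intro measurable_mat_entry) simp_all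
qed

lemma integrable_haar_monomial:
  assumes n: "n > 0" and R: "finite R" and i: "i \<in> R \<rightarrow>\<^sub>E {..<n}" and j: "j \<in> R \<rightarrow>\<^sub>E {..<n}"
  shows "integrable (haar_orth n) (\<lambda>u. \<Prod>r\<in>R. u (i r, j r))"
proof -
  interpret prob_space "haar_orth n" by (rule prob_space_haar_orth [OF n])
  show ?thesis
  proof (rule integrable_const_bound [where B = 1])
    have "norm (\<Prod>r\<in>R. u (i r, j r)) \<le> 1" if u: "u \<in> orth_group n" for u
    proof -
      have "(\<Prod>r\<in>R. \<bar>u (i r, j r)\<bar>) \<le> (\<Prod>r\<in>R. 1)"
        using PiE_mem [OF i] PiE_mem [OF j] orth_group_abs_le_1 [OF u] by (intro prod_mono) simp
      then show ?thesis by (simp add: abs_prod)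
    qed
    then show "AE u in haar_orth n. norm (\<Prod>r\<in>R. u (i r, j r)) \<le> 1"
      by (intro AE_I2) (simp add: space_haar_orth [OF n])
    show "(\<lambda>u. \<Prod>r\<in>R. u (i r, j r)) \<in> borel_measurable (haar_orth n)"
      by (rule borel_measurable_haar_monomial [OF assms])
  qed
qed

text \<open>With the column word \<open>j\<close> fixed, left invariance of the measure becomes
  invariance in the row word once the product of the entries of \<open>g u\<close> is
  expanded.\<close>

lemma invariant_tensor_haar_moment:
  assumes n: "n > 0" and R: "finite R" and j: "j \<in> R \<rightarrow>\<^sub>E {..<n}"
  shows "invariant_tensor n R (\<lambda>i. haar_moment n R i j)"
  unfolding invariant_tensor_def
proof (intro ballI)
  fix g i assume g: "g \<in> orth_group n" and i: "i \<in> R \<rightarrow>\<^sub>E {..<n}"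
  let ?H = "haar_orth n"
  have gm: "mat_mult n g \<in> ?H \<rightarrow>\<^sub>M ?H"
    using measurable_orth_mult_left [OF g] by (simp cong: measurable_cong_sets add: sets_haar_orth [OF n])
  have "haar_moment n R i j = (LINT u|distr ?H ?H (mat_mult n g). (\<Prod>r\<in>R. u (i r, j r)))"
    using left_haar_haar_orth [OF n] g by (simp add: left_haar_def haar_moment_def)
  also have "\<dots> = (LINT u|?H. (\<Prod>r\<in>R. mat_mult n g u (i r, j r)))"
    by (rule integral_distr [OF gm borel_measurable_haar_monomial [OF n R i j]])
  also have "\<dots> = (LINT u|?H. (\<Sum>l\<in>R \<rightarrow>\<^sub>E {..<n}. (\<Prod>r\<in>R. g (i r, l r)) * (\<Prod>r\<in>R. u (l r, j r))))"
  proof (rule Bochner_Integration.integral_cong [OF refl])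
    fix u
    have "(\<Prod>r\<in>R. mat_mult n g u (i r, j r)) = (\<Prod>r\<in>R. \<Sum>x\<in>{..<n}. g (i r, x) * u (x, j r))"
      using PiE_mem [OF i] PiE_mem [OF j] by (intro prod.cong refl mat_mult_apply) simp_all
    also have "\<dots> = (\<Sum>l\<in>R \<rightarrow>\<^sub>E {..<n}. \<Prod>r\<in>R. g (i r, l r) * u (l r, j r))"
      using R by (rule prod_sum_PiE) simp
    finally show "(\<Prod>r\<in>R. mat_mult n g u (i r, j r)) =
        (\<Sum>l\<in>R \<rightarrow>\<^sub>E {..<n}. (\<Prod>r\<in>R. g (i r, l r)) * (\<Prod>r\<in>R. u (l r, j r)))"
      by (simp add: prod.distrib)
  qed
  also have "\<dots> = (\<Sum>l\<in>R \<rightarrow>\<^sub>E {..<n}. (\<Prod>r\<in>R. g (i r, l r)) * haar_moment n R l j)"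
    unfolding haar_moment_def using integrable_haar_monomial [OF n R _ j]
    by (subst Bochner_Integration.integral_sum) simp_all
  finally show "haar_moment n R i j = (\<Sum>l\<in>R \<rightarrow>\<^sub>E {..<n}. (\<Prod>r\<in>R. g (i r, l r)) * haar_moment n R l j)" .
qed

text \<open>Transposition preserves Haar measure and exchanges the two words. This is what later
  turns a right inverse of the Gram matrix into a left inverse.\<close>

lemma haar_moment_commute:
  assumes n: "n > 0" and R: "finite R" and i: "i \<in> R \<rightarrow>\<^sub>E {..<n}" and j: "j \<in> R \<rightarrow>\<^sub>E {..<n}"
  shows "haar_moment n R i j = haar_moment n R j i"
proof -
  let ?H = "haar_orth n"
  have tm: "mat_transp n \<in> ?H \<rightarrow>\<^sub>M ?H"
    using measurable_orth_transp by (simp cong: measurable_cong_sets add: sets_haar_orth [OF n])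
  have "haar_moment n R i j = (LINT u|distr ?H ?H (mat_transp n). (\<Prod>r\<in>R. u (i r, j r)))"
    by (simp add: haar_orth_transp [OF n] haar_moment_def)
  also have "\<dots> = (LINT u|?H. (\<Prod>r\<in>R. mat_transp n u (i r, j r)))"
    by (rule integral_distr [OF tm borel_measurable_haar_monomial [OF n R i j]])
  also have "\<dots> = haar_moment n R j i"
    unfolding haar_moment_def using PiE_mem [OF i] PiE_mem [OF j]
    by (intro Bochner_Integration.integral_cong prod.cong refl mat_transp_apply) simp_all
  finally show ?thesis .
qed

lemma prod_of_bool: "finite A \<Longrightarrow> (\<Prod>x\<in>A. of_bool (P x)) = (of_bool (\<forall>x\<in>A. P x) :: real)"
  by (induction A rule: finite_induct) simp_all

text \<open>Before integration, the sum already factors over the blocks of \<open>p\<close> into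
  inner products of two columns of \<open>u\<close>. These are 0 or 1 for every orthogonal
  \<open>u\<close>, so the integrand is constant.\<close>

lemma sum_compatible_haar_moment:
  assumes n: "n > 0" and p: "p \<in> pairings k" and j: "j \<in> {1..2*k} \<rightarrow>\<^sub>E {..<n}"
  shows "(\<Sum>i\<in>{i \<in> {1..2*k} \<rightarrow>\<^sub>E {..<n}. compatible p i}. haar_moment n {1..2*k} i j) = of_bool (compatible p j)"
proof -
  interpret prob_space "haar_orth n" by (rule prob_space_haar_orth [OF n])
  let ?R = "{1..2*k}"
  have "(\<Sum>i\<in>{i \<in> ?R \<rightarrow>\<^sub>E {..<n}. compatible p i}. haar_moment n ?R i j)
      = (LINT u|haar_orth n. (\<Sum>i\<in>{i \<in> ?R \<rightarrow>\<^sub>E {..<n}. compatible p i}. \<Prod>r\<in>?R. u (i r, j r)))"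
    unfolding haar_moment_def using integrable_haar_monomial [OF n _ _ j]
    by (subst Bochner_Integration.integral_sum) simp_all
  also have "\<dots> = (LINT u|haar_orth n. of_bool (compatible p j))"
  proof (rule Bochner_Integration.integral_cong [OF refl])
    fix u assume "u \<in> space (haar_orth n)"
    then have u: "u \<in> orth_group n" by (simp add: space_haar_orth [OF n])
    have "(\<Sum>i\<in>{i \<in> ?R \<rightarrow>\<^sub>E {..<n}. compatible p i}. \<Prod>r\<in>?R. u (i r, j r))
        = (\<Prod>B\<in>p. \<Sum>x\<in>{..<n}. \<Prod>r\<in>B. u (x, j r))"
      by (rule sum_compatible_eq_prod_blocks [OF pairings_partition [OF p]]) simp_all
    also have "\<dots> = (\<Prod>B\<in>p. of_bool (\<forall>x\<in>B. \<forall>y\<in>B. j x = j y))"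
    proof (rule prod.cong [OF refl])
      fix B assume B: "B \<in> p"
      obtain x y where xy: "B = {x, y}" "x \<noteq> y"
        using pairings_card [OF p B] by (auto simp: card_2_iff)
      have "x \<in> ?R" "y \<in> ?R" using B xy pairings_Union [OF p] by blast+
      then have "j x < n" "j y < n" using PiE_mem [OF j] by simp_all
      then have "(\<Sum>l<n. u (l, j x) * u (l, j y)) = (if j x = j y then 1 else 0)"
        by (rule orth_group_columns [OF u])
      moreover have "(\<forall>x\<in>B. \<forall>y\<in>B. j x = j y) \<longleftrightarrow> j x = j y"
        unfolding xy(1) by auto
      ultimately show "(\<Sum>l\<in>{..<n}. \<Prod>r\<in>B. u (l, j r)) = of_bool (\<forall>x\<in>B. \<forall>y\<in>B. j x = j y)"
        using xy(2) by (simp only: of_bool_def) (simp add: xy(1))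
    qed
    also have "\<dots> = of_bool (compatible p j)"
      unfolding compatible_def by (rule prod_of_bool [OF pairings_card_eq(1) [OF p]])
    finally show "(\<Sum>i\<in>{i \<in> ?R \<rightarrow>\<^sub>E {..<n}. compatible p i}. \<Prod>r\<in>?R. u (i r, j r)) = of_bool (compatible p j)" .
  qed
  also have "\<dots> = of_bool (compatible p j)" by (simp add: prob_space)
  finally show ?thesis .
qed

section \<open>The inverse of the Gram matrix as a matrix of moments\<close>

lemma compatible_labels_iff:
  assumes p: "p \<in> pairings k" and q: "q \<in> pairings k" and l: "labels q l"
  shows "compatible p l \<longleftrightarrow> p = q"
proof
  assume c: "compatible p l"
  have sub: "B \<in> q" if B: "B \<in> p" for B
  proof -
    obtain x y where xy: "B = {x, y}" "x \<noteq> y"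
      using pairings_card [OF p B] by (auto simp: card_2_iff)
    have "x \<in> \<Union>q" "y \<in> \<Union>q" using B xy pairings_Union [OF p] pairings_Union [OF q] by blast+
    moreover have "l x = l y" using compatibleD [OF c B] xy by simp
    ultimately obtain C where C: "C \<in> q" "x \<in> C" "y \<in> C" using labelsD [OF l] by blast
    have "B = C"
      using C xy pairings_card [OF q C(1)] pairings_card [OF p B] pairings_finite_block [OF q C(1)]
      by (intro card_subset_eq) simp_all
    then show ?thesis using C by simp
  qed
  \<comment> \<open>Both pairings have \<open>k\<close> blocks, so the inclusion is an
    equality.\<close>
  then have "p \<subseteq> q" by blast
  then show "p = q"
    using pairings_card_eq [OF p] pairings_card_eq [OF q] by (intro card_subset_eq) simp_all
next
  assume "p = q"
  then show "compatible p l" using l unfolding compatible_def labels_def by blast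
qed

text \<open>After exchanging the sums, the sum over \<open>t\<close> is the expansion of the moment
  tensor at the word \<open>i\<close>. The remaining sum over the words compatible with
  \<open>p\<close> collapses to the question whether \<open>p\<close> is compatible with
  \<open>M q\<close>, a word whose kernel is \<open>q\<close>.\<close>

lemma gram_haar_moment:
  assumes kn: "k \<le> n" and n: "n > 0"
    and L: "\<And>t. t \<in> pairings k \<Longrightarrow> L t \<in> {1..2*k} \<rightarrow>\<^sub>E {..<n}" "\<And>t. t \<in> pairings k \<Longrightarrow> labels t (L t)"
    and M: "\<And>t. t \<in> pairings k \<Longrightarrow> M t \<in> {1..2*k} \<rightarrow>\<^sub>E {..<n}" "\<And>t. t \<in> pairings k \<Longrightarrow> labels t (M t)"
    and p: "p \<in> pairings k" and q: "q \<in> pairings k"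
  shows "(\<Sum>t\<in>pairings k. gram k n p t * haar_moment n {1..2*k} (L t) (M q)) = (if p = q then 1 else 0)"
proof -
  let ?P = "{1..2*k} \<rightarrow>\<^sub>E {..<n}"
  let ?T = "\<lambda>i. haar_moment n {1..2*k} i (M q)"
  have finP: "finite ?P" by (simp add: finite_PiE)
  have T: "invariant_tensor n {1..2*k} ?T"
    by (rule invariant_tensor_haar_moment [OF n _ M(1) [OF q]]) simp
  have "(\<Sum>t\<in>pairings k. gram k n p t * ?T (L t))
      = (\<Sum>t\<in>pairings k. \<Sum>i\<in>?P. of_bool (compatible p i) * (of_bool (compatible t i) * ?T (L t)))"
    by (intro sum.cong refl) (simp add: gram_eq_sum [OF p] sum_distrib_right mult.assoc)
  also have "\<dots> = (\<Sum>i\<in>?P. of_bool (compatible p i) * (\<Sum>t\<in>pairings k. of_bool (compatible t i) * ?T (L t)))"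
    by (subst sum.swap) (simp only: sum_distrib_left)
  also have "\<dots> = (\<Sum>i\<in>?P. if compatible p i then ?T i else 0)"
  proof (rule sum.cong [OF refl])
    fix i assume i: "i \<in> ?P"
    have "(\<Sum>t\<in>pairings k. of_bool (compatible t i) * ?T (L t)) = (\<Sum>t\<in>{t\<in>pairings k. compatible t i}. ?T (L t))"
      by (simp only: sum.inter_filter [OF finite_pairings]) (intro sum.cong refl, simp)
    also have "\<dots> = ?T i"
      by (rule invariant_tensor_expansion [symmetric, OF T kn L i])
    finally show "of_bool (compatible p i) * (\<Sum>t\<in>pairings k. of_bool (compatible t i) * ?T (L t)) =
        (if compatible p i then ?T i else 0)" by simp
  qed
  also have "\<dots> = (\<Sum>i\<in>{i\<in>?P. compatible p i}. ?T i)"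
    using finP by (subst sum.inter_filter) simp_all
  also have "\<dots> = of_bool (compatible p (M q))"
    by (rule sum_compatible_haar_moment [OF n p M(1) [OF q]])
  also have "\<dots> = (if p = q then 1 else 0)"
    using compatible_labels_iff [OF p q M(2) [OF q]] by simp
  finally show ?thesis .
qed

text \<open>Two independent families of words are allowed, \<open>L\<close> for rows and
  \<open>M\<close> for columns, so that the labellings of the two given pairings can be prescribed
  separately.\<close>

lemma weingarten_eq_haar_moment:
  assumes kn: "k \<le> n" and n: "n > 0"
    and L: "\<And>t. t \<in> pairings k \<Longrightarrow> L t \<in> {1..2*k} \<rightarrow>\<^sub>E {..<n}" "\<And>t. t \<in> pairings k \<Longrightarrow> labels t (L t)"
    and M: "\<And>t. t \<in> pairings k \<Longrightarrow> M t \<in> {1..2*k} \<rightarrow>\<^sub>E {..<n}" "\<And>t. t \<in> pairings k \<Longrightarrow> labels t (M t)"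
    and p: "p \<in> pairings k" and q: "q \<in> pairings k"
  shows "weingarten k n p q = haar_moment n {1..2*k} (L p) (M q)"
proof -
  define W where "W p q = (if p \<in> pairings k \<and> q \<in> pairings k then haar_moment n {1..2*k} (L p) (M q) else 0)" for p q
  let ?D = "pairings k"
  have right: "(\<Sum>t\<in>?D. gram k n p t * W t q) = (if p = q then 1 else 0)" if "p \<in> ?D" "q \<in> ?D" for p q
    using gram_haar_moment [OF kn n L M that] that by (simp add: W_def)
  \<comment> \<open>The left inverse is the right inverse for exchanged families \<open>M\<close>
    and \<open>L\<close>, by symmetry of the Gram matrix and of the moments.\<close>
  have left: "(\<Sum>t\<in>?D. W p t * gram k n t q) = (if p = q then 1 else 0)" if pq: "p \<in> ?D" "q \<in> ?D" for p q
  proof -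
    have "(\<Sum>t\<in>?D. W p t * gram k n t q) = (\<Sum>t\<in>?D. gram k n q t * haar_moment n {1..2*k} (M t) (L p))"
    proof (rule sum.cong [OF refl])
      fix t assume t: "t \<in> ?D"
      have "haar_moment n {1..2*k} (L p) (M t) = haar_moment n {1..2*k} (M t) (L p)"
        using L(1) M(1) t pq by (intro haar_moment_commute n) simp_all
      then show "W p t * gram k n t q = gram k n q t * haar_moment n {1..2*k} (M t) (L p)"
        using t pq gram_commute [OF t pq(2)] by (simp add: W_def)
    qed
    also have "\<dots> = (if q = p then 1 else 0)"
      by (rule gram_haar_moment [OF kn n M L pq(2,1)])
    finally show ?thesis by (simp add: eq_commute)
  qed
  have "weingarten k n = W"
    unfolding weingarten_def
  proof (rule the_equality)
    show "(\<forall>p q. p \<notin> ?D \<or> q \<notin> ?D \<longrightarrow> W p q = 0) \<and>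
        (\<forall>p\<in>?D. \<forall>q\<in>?D. (\<Sum>t\<in>?D. gram k n p t * W t q) = (if p = q then 1 else 0)) \<and>
        (\<forall>p\<in>?D. \<forall>q\<in>?D. (\<Sum>t\<in>?D. W p t * gram k n t q) = (if p = q then 1 else 0))"
      using left right by (simp add: W_def)
    fix V assume V: "(\<forall>p q. p \<notin> ?D \<or> q \<notin> ?D \<longrightarrow> V p q = 0) \<and>
        (\<forall>p\<in>?D. \<forall>q\<in>?D. (\<Sum>t\<in>?D. gram k n p t * V t q) = (if p = q then 1 else 0)) \<and>
        (\<forall>p\<in>?D. \<forall>q\<in>?D. (\<Sum>t\<in>?D. V p t * gram k n t q) = (if p = q then 1 else 0))"
    \<comment> \<open>Uniqueness of inverses: with \<open>G\<close> the Gram matrix, V = (W G) V = W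
      (G V) = W.\<close>
    have "V p q = W p q" if pq: "p \<in> ?D" "q \<in> ?D" for p q
    proof -
      have "V p q = (\<Sum>t\<in>?D. if p = t then V t q else 0)"
        using pq by simp
      also have "\<dots> = (\<Sum>t\<in>?D. (\<Sum>s\<in>?D. W p s * gram k n s t) * V t q)"
        using left pq(1) by (intro sum.cong refl) simp
      also have "\<dots> = (\<Sum>t\<in>?D. \<Sum>s\<in>?D. W p s * (gram k n s t * V t q))"
        by (simp add: sum_distrib_right mult.assoc)
      also have "\<dots> = (\<Sum>s\<in>?D. W p s * (\<Sum>t\<in>?D. gram k n s t * V t q))"
        by (subst sum.swap) (simp add: sum_distrib_left)
      also have "\<dots> = (\<Sum>s\<in>?D. if s = q then W p s else 0)"
        using V pq(2) by (intro sum.cong refl) simp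
      also have "\<dots> = W p q" using pq by simp
      finally show ?thesis .
    qed
    moreover have "V p q = W p q" if "p \<notin> ?D \<or> q \<notin> ?D" for p q
      using V that by (auto simp: W_def)
    ultimately show "V = W" by blast
  qed
  then show ?thesis using p q by (simp add: W_def)
qed

text \<open>The word sends a position to the index of its string. Its letters are below
  \<open>k\<close>, hence below \<open>n\<close>, and prescribing the enumeration \<open>l\<close>
  ties the word to the given labelling of the strings.\<close>

lemma ex_labels:
  assumes t: "t \<in> pairings k" and b: "bij_betw l {..<k} t" and kn: "k \<le> n"
  obtains L where "L \<in> {1..2*k} \<rightarrow>\<^sub>E {..<n}" "labels t L"
    "\<And>r i. r \<in> {1..2*k} \<Longrightarrow> i < k \<Longrightarrow> r \<in> l i \<longleftrightarrow> L r = i" "\<And>r. r \<in> {1..2*k} \<Longrightarrow> L r < k"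
proof -
  note part = pairings_partition [OF t]
  have lt: "l i \<in> t" if "i < k" for i using b that by (auto simp: bij_betw_def)
  have inj: "i = j" if "i < k" "j < k" "l i = l j" for i j
    using b that by (auto simp: bij_betw_def inj_on_def)
  have "\<exists>i<k. r \<in> l i" if r: "r \<in> {1..2*k}" for r
  proof -
    obtain B where B: "B \<in> t" "r \<in> B" using partition_on_block [OF part r] by blast
    then have "B \<in> l ` {..<k}" using b by (simp add: bij_betw_def)
    then show ?thesis using B by blast
  qed
  then obtain f where f: "\<And>r. r \<in> {1..2*k} \<Longrightarrow> f r < k \<and> r \<in> l (f r)" by metis
  have uniq: "r \<in> l i \<longleftrightarrow> f r = i" if r: "r \<in> {1..2*k}" and i: "i < k" for r i
  proof
    assume "r \<in> l i"
    then have "l (f r) = l i" using f [OF r] partition_on_block_eq [OF part lt lt [OF i], of "f r" r] by blast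
    then show "f r = i" using inj f [OF r] i by blast
  next
    assume "f r = i"
    then show "r \<in> l i" using f [OF r] by blast
  qed
  let ?L = "\<lambda>r\<in>{1..2*k}. f r"
  have "labels t ?L"
    unfolding labels_def pairings_Union [OF t]
  proof (intro ballI)
    fix x y assume xy: "x \<in> {1..2*k}" "y \<in> {1..2*k}"
    have "f x = f y \<longleftrightarrow> (\<exists>B\<in>t. x \<in> B \<and> y \<in> B)"
    proof
      assume "f x = f y"
      then show "\<exists>B\<in>t. x \<in> B \<and> y \<in> B" using f [OF xy(1)] f [OF xy(2)] lt [of "f x"] by force
    next
      assume "\<exists>B\<in>t. x \<in> B \<and> y \<in> B"
      then obtain B where B: "B \<in> t" "x \<in> B" "y \<in> B" by blast
      then obtain i where "i < k" "B = l i" using b unfolding bij_betw_def by blast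
      then show "f x = f y" using uniq [OF xy(1)] uniq [OF xy(2)] B by blast
    qed
    then show "?L x = ?L y \<longleftrightarrow> (\<exists>B\<in>t. x \<in> B \<and> y \<in> B)"
      using xy by (simp del: atLeastAtMost_iff)
  qed
  moreover have "?L \<in> {1..2*k} \<rightarrow>\<^sub>E {..<n}"
    using f kn by (simp add: PiE_iff del: atLeastAtMost_iff) (meson less_le_trans)
  ultimately show thesis
    using uniq f by (intro that [of ?L]) (simp_all del: atLeastAtMost_iff)
qed

theorem theorem2p3:
  fixes k n :: nat and p s :: "nat set set" and lp ls :: "nat \<Rightarrow> nat set"
  assumes "k \<ge> 1" and "n \<ge> k"
    and "p \<in> pairings k" and "s \<in> pairings k"
    and "bij_betw lp {..<k} p" and "bij_betw ls {..<k} s"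
  shows "weingarten k n p s =
           orth_integral n k k (\<lambda>i j. card {r \<in> {1..2*k}. r \<in> lp i \<and> r \<in> ls j})"
proof -
  let ?R = "{1..2*k}"
  have n: "n > 0" using assms by simp
  obtain A where A: "A \<in> ?R \<rightarrow>\<^sub>E {..<n}" "labels p A"
    "\<And>r i. r \<in> ?R \<Longrightarrow> i < k \<Longrightarrow> r \<in> lp i \<longleftrightarrow> A r = i" "\<And>r. r \<in> ?R \<Longrightarrow> A r < k"
    using ex_labels [OF assms(3,5,2)] by blast
  obtain B where B: "B \<in> ?R \<rightarrow>\<^sub>E {..<n}" "labels s B"
    "\<And>r i. r \<in> ?R \<Longrightarrow> i < k \<Longrightarrow> r \<in> ls i \<longleftrightarrow> B r = i" "\<And>r. r \<in> ?R \<Longrightarrow> B r < k"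
    using ex_labels [OF assms(4,6,2)] by blast
  have "\<exists>L. L \<in> ?R \<rightarrow>\<^sub>E {..<n} \<and> labels t L" if t: "t \<in> pairings k" for t
  proof -
    obtain l where l: "bij_betw l {..<k} t"
      using ex_bij_betw_nat_finite [OF pairings_card_eq(1) [OF t]] pairings_card_eq(2) [OF t]
      by (auto simp: atLeast0LessThan)
    obtain L where "L \<in> ?R \<rightarrow>\<^sub>E {..<n}" "labels t L" using ex_labels [OF t l assms(2)] .
    then show ?thesis by blast
  qed
  then obtain L where L: "\<And>t. t \<in> pairings k \<Longrightarrow> L t \<in> ?R \<rightarrow>\<^sub>E {..<n}" "\<And>t. t \<in> pairings k \<Longrightarrow> labels t (L t)"
    by metis
  \<comment> \<open>The words \<open>A\<close> and \<open>B\<close> are imposed at \<open>p\<close>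
    in the row family and at \<open>s\<close> in the column family; all other pairings keep an
    arbitrary labelling.\<close>
  have LA: "(L(p := A)) t \<in> ?R \<rightarrow>\<^sub>E {..<n}" "labels t ((L(p := A)) t)" if "t \<in> pairings k" for t
    using L A that by simp_all
  have LB: "(L(s := B)) t \<in> ?R \<rightarrow>\<^sub>E {..<n}" "labels t ((L(s := B)) t)" if "t \<in> pairings k" for t
    using L B that by simp_all
  have "weingarten k n p s = haar_moment n ?R ((L(p := A)) p) ((L(s := B)) s)"
    using LA LB by (rule weingarten_eq_haar_moment [OF assms(2) n _ _ _ _ assms(3,4)])
  also have "\<dots> = haar_moment n ?R A B" by simp
  also have "\<dots> = orth_integral n k k (\<lambda>i j. card {r \<in> ?R. r \<in> lp i \<and> r \<in> ls j})"
    unfolding haar_moment_def orth_integral_def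
  proof (rule Bochner_Integration.integral_cong [OF refl])
    fix u :: "nat \<times> nat \<Rightarrow> real"
    let ?I = "{..<k} \<times> {..<k}"
    \<comment> \<open>Positions are grouped by the pair of strings containing them; a pair of
      strings without common position contributes a zeroth power, hence the factor 1.\<close>
    have "(\<Prod>r\<in>?R. u (A r, B r)) = (\<Prod>ij\<in>?I. \<Prod>r\<in>{r\<in>?R. (A r, B r) = ij}. u (A r, B r))"
      using A(4) B(4) by (intro prod.group [symmetric]) auto
    also have "\<dots> = (\<Prod>ij\<in>?I. u ij ^ card {r\<in>?R. r \<in> lp (fst ij) \<and> r \<in> ls (snd ij)})"
    proof (rule prod.cong [OF refl])
      fix ij assume ij: "ij \<in> ?I"
      have power: "(\<Prod>r\<in>{r\<in>?R. (A r, B r) = ij}. u (A r, B r)) = u ij ^ card {r\<in>?R. (A r, B r) = ij}"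
        by (simp cong: prod.cong_simp)
      have fibre: "{r\<in>?R. (A r, B r) = ij} = {r\<in>?R. r \<in> lp (fst ij) \<and> r \<in> ls (snd ij)}"
        using ij A(3) B(3) by (intro Collect_cong conj_cong refl) (auto simp del: atLeastAtMost_iff)
      show "(\<Prod>r\<in>{r\<in>?R. (A r, B r) = ij}. u (A r, B r))
          = u ij ^ card {r\<in>?R. r \<in> lp (fst ij) \<and> r \<in> ls (snd ij)}"
        using power unfolding fibre .
    qed
    finally show "(\<Prod>r\<in>?R. u (A r, B r)) = (\<Prod>i<k. \<Prod>j<k. u (i, j) ^ card {r\<in>?R. r \<in> lp i \<and> r \<in> ls j})"
      by (simp add: prod.cartesian_product case_prod_unfold)
  qed
  finally show ?thesis .
qed

end
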